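(* There exists a constant $c > 0$ such that, given a positive integer $k := k(n) = o(n)$, the bound $$h(G \cup \mathbb{G}(n,p)) = \Omega\left(\frac{n}{\sqrt{\log n}\cdot \max\left\{\sqrt{\alpha(G)},\; \log n\right\}\cdot k}\right)$$ holds asymptotically almost surely whenever $G$ is an $n$-vertex graph satisfying $\alpha(G) \leq \frac{c n}{k}$ and $p := p(n) = \frac{8}{nk}$.
   Context: $\mathbb{G}(n,p)$ is the binomial random graph on the same $n$-element vertex set as $G$ (each pair is an edge independently with probability $p$), and $G \cup \mathbb{G}(n,p)$ is the random graph $G \cup R$ (union of edge sets) with $R \sim \mathbb{G}(n,p)$. A graph $H$ is a minor of a graph $K$ if $H$ can be obtained from a subgraph of $K$ through a series of edge-contractions. The Hadwiger number $h(K)$ is the largest integer $r$ such that $K$ contains the complete graph $K_r$ as a minor. $\alpha(G)$ is the independence number of $G$. "Asymptotically almost surely" means with probability tending to $1$ as $n \to \infty$, for every choice of $n$-vertex graphs $G = G_n$ satisfying the hypotheses. The constant implicit in $\Omega$ is positive and does not depend on $n$ or $G$. $\log$ is the natural logarithm. *)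

theory Defs
  imports "HOL-Probability.Probability" "HOL-Library.Ramsey" "HOL-Library.Landau_Symbols"
begin

type_synonym 'a graph = "'a set \<times> 'a set set"

abbreviation verts :: "'a graph \<Rightarrow> 'a set" where "verts \<equiv> fst"

abbreviation edges :: "'a graph \<Rightarrow> 'a set set" where "edges \<equiv> snd"

text \<open>Finite simple graphs; the empty graph is allowed.\<close>

definition simple_graph :: "'a graph \<Rightarrow> bool" where
  "simple_graph G \<longleftrightarrow> finite (verts G) \<and> edges G \<subseteq> [verts G]\<^bsup>2\<^esup>"

definition complete_graph :: "nat \<Rightarrow> nat graph" where
  "complete_graph r = ({..<r}, [{..<r}]\<^bsup>2\<^esup>)"

definition subgraph :: "'a graph \<Rightarrow> 'a graph \<Rightarrow> bool" where
  "subgraph H G \<longleftrightarrow> simple_graph H \<and> verts H \<subseteq> verts G \<and> edges H \<subseteq> edges G"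

definition graph_iso :: "'a graph \<Rightarrow> 'b graph \<Rightarrow> bool" where
  "graph_iso G H \<longleftrightarrow>
     (\<exists>f. bij_betw f (verts G) (verts H) \<and> edges H = (\<lambda>e. f ` e) ` edges G)"

text \<open>
  Contraction of the edge \<open>uv\<close>: the merged vertex keeps the name \<open>u\<close>. The cardinality condition
  discards the loop coming from \<open>uv\<close> itself; parallel edges are identified because the edges form
  a set.
\<close>

definition contract_edge :: "'a \<Rightarrow> 'a \<Rightarrow> 'a graph \<Rightarrow> 'a graph" where
  "contract_edge u v G =
     (let f = (\<lambda>w. if w = v then u else w)
      in (f ` verts G, {e \<in> (\<lambda>e. f ` e) ` edges G. card e = 2}))"

definition contracts_to :: "'a graph \<Rightarrow> 'a graph \<Rightarrow> bool" where
  "contracts_to G H \<longleftrightarrow> (\<exists>u v. {u, v} \<in> edges G \<and> H = contract_edge u v G)"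

definition is_minor :: "'b graph \<Rightarrow> 'a graph \<Rightarrow> bool" where
  "is_minor H K \<longleftrightarrow> (\<exists>S T. subgraph S K \<and> contracts_to\<^sup>*\<^sup>* S T \<and> graph_iso T H)"

definition hadwiger_number :: "'a graph \<Rightarrow> nat" where
  "hadwiger_number K = Max {r. is_minor (complete_graph r) K}"

definition independence_number :: "'a graph \<Rightarrow> nat" where
  "independence_number G = Max {card S |S. S \<subseteq> verts G \<and> indep S (edges G)}"

text \<open>
  The binomial random graph on \<open>V\<close>, as a distribution on graphs. The library's \<open>bernoulli_pmf p\<close>
  truncates \<open>p\<close> to the interval from 0 to 1.
\<close>

definition binomial_random_graph :: "'a set \<Rightarrow> real \<Rightarrow> 'a graph pmf" where
  "binomial_random_graph V p =
     map_pmf (\<lambda>b. (V, {e \<in> [V]\<^bsup>2\<^esup>. b e})) (Pi_pmf ([V]\<^bsup>2\<^esup>) False (\<lambda>_. bernoulli_pmf p))"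

definition graph_union :: "'a graph \<Rightarrow> 'a graph \<Rightarrow> 'a graph" where
  "graph_union G R = (verts G \<union> verts R, edges G \<union> edges R)"

text \<open>
  Sanity check: on finite simple graphs the maxima above are taken over finite nonempty sets.
\<close>

lemma contracts_to_card_verts_le:
  assumes "contracts_to\<^sup>*\<^sup>* S T" "finite (verts S)"
  shows "finite (verts T) \<and> card (verts T) \<le> card (verts S)"
  using assms
proof (induction rule: rtranclp_induct)
  case (step T U)
  have "\<exists>f. verts U = f ` verts T"
    using step.hyps(2) unfolding contracts_to_def contract_edge_def Let_def
    by (elim exE conjE) (simp only: fst_conv, rule exI, rule refl)
  then obtain f where "verts U = f ` verts T" ..
  with step show ?case
    using card_image_le[of "verts T" f] by auto
qed simp

lemma hadwiger_set_finite_nonempty: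
  assumes "simple_graph K"
  shows "finite {r. is_minor (complete_graph r) K}" "{r. is_minor (complete_graph r) K} \<noteq> {}"
proof -
  have "r \<le> card (verts K)" if "is_minor (complete_graph r) K" for r
  proof -
    from that obtain S T where ST: "subgraph S K" "contracts_to\<^sup>*\<^sup>* S T" "graph_iso T (complete_graph r)"
      by (auto simp: is_minor_def)
    have "card (verts T) = r"
      using ST(3) bij_betw_same_card unfolding graph_iso_def complete_graph_def by fastforce
    moreover have "finite (verts S)" "card (verts S) \<le> card (verts K)"
      using ST(1) assms card_mono[of "verts K" "verts S"]
      unfolding subgraph_def simple_graph_def by blast+
    ultimately show ?thesis
      using contracts_to_card_verts_le[OF ST(2)] by simp
  qed
  then show "finite {r. is_minor (complete_graph r) K}"
    unfolding finite_nat_set_iff_bounded_le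
    by (intro exI[of _ "card (verts K)"] ballI) simp
  have "is_minor (complete_graph 0) K"
    unfolding is_minor_def
  proof (intro exI conjI)
    show "subgraph ({}, {}) K"
      by (simp add: subgraph_def simple_graph_def)
    show "contracts_to\<^sup>*\<^sup>* ({}, {}) ({} :: 'a set, {})" ..
    have "[{} :: nat set]\<^bsup>2\<^esup> = {}"
      by (simp add: nsets_2_eq)
    then show "graph_iso ({} :: 'a set, {}) (complete_graph 0)"
      by (simp add: graph_iso_def complete_graph_def bij_betw_def)
  qed
  then show "{r. is_minor (complete_graph r) K} \<noteq> {}" by blast
qed

lemma independence_set_finite_nonempty:
  assumes "simple_graph G"
  shows "finite {card S |S. S \<subseteq> verts G \<and> indep S (edges G)}"
    "{card S |S. S \<subseteq> verts G \<and> indep S (edges G)} \<noteq> {}"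
proof -
  have "finite (card ` Pow (verts G))"
    using assms by (simp add: simple_graph_def)
  then show "finite {card S |S. S \<subseteq> verts G \<and> indep S (edges G)}"
    by (rule rev_finite_subset) blast
  show "{card S |S. S \<subseteq> verts G \<and> indep S (edges G)} \<noteq> {}"
    unfolding Collect_empty_eq not_all not_not
    by (rule exI, rule exI[of _ "{}"]) simp
qed

end

theory Submission
  imports Defs "HOL-Combinatorics.Permutations" "HOL-Real_Asymp.Real_Asymp"
begin

text \<open>
  As \<open>G\<close> has small independence number, all but a small fraction of its vertices can be split
  into disjoint connected pieces with exactly \<open>k\<close> vertices each. Between the \<open>N \<approx> n / k\<close> pieces
  the random edges form a binomial random graph with average degree about 8, which contains a path
  through linearly many pieces. The law of the random edges is invariant under permuting the pieces,
  so this path visits them in a uniformly random order. Cut it into segments of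
  \<open>s = \<Theta>(sqrt (log n) * max {sqrt \<alpha>, log n})\<close> pieces. Exposing one segment piece by piece, each new
  piece has a constant probability of being adjacent in \<open>G\<close> to at least \<open>N / (4 \<alpha>)\<close> further pieces,
  because few vertices can have low degree in a graph of small independence number. Hence the
  segment sees about \<open>s N / \<alpha>\<close> pieces and a second segment misses all of them with
  probability about \<open>exp (- s\<^sup>2 / \<alpha>)\<close>. So all segments are pairwise adjacent, and contracting
  them gives a complete minor.
\<close>

section \<open>Connected pieces\<close>

text \<open>Connectivity of the subgraph induced on \<open>X\<close>: the connecting walks stay
  inside \<open>X\<close>, and the empty set counts as linked. A relation serves in place of a
  graph, so that linkedness passes from \<open>G\<close> to its union with the random edges.\<close>

definition linked :: "('a \<Rightarrow> 'a \<Rightarrow> bool) \<Rightarrow> 'a set \<Rightarrow> bool" where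
  "linked E X \<longleftrightarrow> (\<forall>x\<in>X. \<forall>y\<in>X. (\<lambda>a b. a \<in> X \<and> b \<in> X \<and> E a b)\<^sup>*\<^sup>* x y)"

lemma linked_mono:
  assumes "linked E X" "\<And>a b. a \<in> X \<Longrightarrow> b \<in> X \<Longrightarrow> E a b \<Longrightarrow> F a b"
  shows "linked F X"
  unfolding linked_def
proof (intro ballI)
  fix x y assume "x \<in> X" "y \<in> X"
  then have "(\<lambda>a b. a \<in> X \<and> b \<in> X \<and> E a b)\<^sup>*\<^sup>* x y"
    using assms(1) by (auto simp: linked_def)
  then show "(\<lambda>a b. a \<in> X \<and> b \<in> X \<and> F a b)\<^sup>*\<^sup>* x y"
    by (rule rtranclp_mono[THEN predicate2D, rotated]) (use assms(2) in auto)
qed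

lemma linked_singleton [simp]: "linked E {x}"
  by (simp add: linked_def)

lemma linked_Un:
  assumes X: "linked E X" and Y: "linked E Y"
    and xy: "x \<in> X" "y \<in> Y" "E x y" and sym: "symp E"
  shows "linked E (X \<union> Y)"
proof -
  let ?R = "\<lambda>a b. a \<in> X \<union> Y \<and> b \<in> X \<union> Y \<and> E a b"
  have sub: "?R\<^sup>*\<^sup>* a b" if "linked E Z" "Z \<subseteq> X \<union> Y" "a \<in> Z" "b \<in> Z" for Z a b
  proof -
    have "(\<lambda>a b. a \<in> Z \<and> b \<in> Z \<and> E a b)\<^sup>*\<^sup>* a b"
      using that by (auto simp: linked_def)
    then show ?thesis
      by (rule rtranclp_mono[THEN predicate2D, rotated]) (use that in auto)
  qed
  have "?R x y" "?R y x" using xy sym by (auto dest: sympD)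
  then have st: "?R\<^sup>*\<^sup>* x y" "?R\<^sup>*\<^sup>* y x" by blast+
  have to_x: "?R\<^sup>*\<^sup>* a x" if "a \<in> X \<union> Y" for a
    using that sub[OF X, of a x] sub[OF Y, of a y] st(2) xy by (auto intro: rtranclp_trans)
  have from_x: "?R\<^sup>*\<^sup>* x a" if "a \<in> X \<union> Y" for a
    using that sub[OF X, of x a] sub[OF Y, of y a] st(1) xy by (auto intro: rtranclp_trans)
  show ?thesis
    unfolding linked_def using to_x from_x by (blast intro: rtranclp_trans)
qed

text \<open>Induction along the list: one edge joins the first piece to the union of the later ones,
  which is already linked.\<close>

lemma linked_Union_path:
  assumes "successively (\<lambda>i j. \<exists>x\<in>P i. \<exists>y\<in>P j. E x y) xs" "\<And>i. i \<in> set xs \<Longrightarrow> linked E (P i)" "symp E"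
  shows "linked E (\<Union>i\<in>set xs. P i)"
  using assms(1,2)
proof (induction xs rule: induct_list012)
  case 1 then show ?case by (simp add: linked_def)
next
  case (2 x) then show ?case by simp
next
  case (3 i j xs)
  then obtain x y where xy: "x \<in> P i" "y \<in> P j" "E x y" by auto
  have "linked E (\<Union>i\<in>set (j # xs). P i)" by (rule "3.IH"(2)) (use 3 in auto)
  moreover have "y \<in> (\<Union>i\<in>set (j # xs). P i)" using xy by auto
  ultimately have "linked E (P i \<union> (\<Union>i\<in>set (j # xs). P i))"
    using linked_Un xy(1,3) assms(3) 3(4)[of i] by (metis list.set_intros(1))
  then show ?case by simp
qed

text \<open>
  Greedy step: grow a linked set from a vertex until it has \<open>k\<close> elements. If this gets stuck
  earlier, the set is a union of components and its starting vertex extends the independent set.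
\<close>

lemma linked_pieces:
  assumes "finite U" "symp E" "k > 0"
  shows "\<exists>\<P> I. finite \<P> \<and> disjoint \<P> \<and> (\<forall>X\<in>\<P>. X \<subseteq> U \<and> card X = k \<and> linked E X) \<and>
    I \<subseteq> U \<and> (\<forall>x\<in>I. \<forall>y\<in>I. x \<noteq> y \<longrightarrow> \<not> E x y) \<and> card U \<le> k * card \<P> + (k - 1) * card I"
  using assms(1)
proof (induction U rule: finite_psubset_induct)
  case (psubset U)
  show ?case
  proof (cases "U = {}")
    case True
    then show ?thesis by (intro exI[of _ "{}"]) auto
  next
    case False
    then obtain u where u: "u \<in> U" by auto
    define \<C> where "\<C> = {X. X \<subseteq> U \<and> u \<in> X \<and> linked E X \<and> card X \<le> k}"
    have "finite \<C>" unfolding \<C>_def using psubset.hyps by auto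
    moreover have "{u} \<in> \<C>" using u assms(3) by (auto simp: \<C>_def)
    ultimately have mx: "Max (card ` \<C>) \<in> card ` \<C>" "\<And>Y. Y \<in> \<C> \<Longrightarrow> card Y \<le> Max (card ` \<C>)"
      by (auto intro!: Max_in)
    then obtain X where X: "X \<in> \<C>" and cX: "card X = Max (card ` \<C>)" by auto
    have Xmax: "card Y \<le> card X" if "Y \<in> \<C>" for Y
      using mx(2)[OF that] cX by simp
    have fX: "finite X" using X psubset.hyps finite_subset by (auto simp: \<C>_def)
    have XU: "X \<subseteq> U" "u \<in> X" "linked E X" "card X \<le> k" using X by (auto simp: \<C>_def)
    have "U - X \<subset> U" using XU u by auto
    then obtain \<P> I where IH: "finite \<P>" "disjoint \<P>" "\<And>Y. Y \<in> \<P> \<Longrightarrow> Y \<subseteq> U - X \<and> card Y = k \<and> linked E Y"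
      "I \<subseteq> U - X" "\<forall>x\<in>I. \<forall>y\<in>I. x \<noteq> y \<longrightarrow> \<not> E x y"
      "card (U - X) \<le> k * card \<P> + (k - 1) * card I"
      using psubset.IH by meson
    have fI: "finite I" using IH(4) psubset.hyps finite_subset by blast
    have cU: "card U = card X + card (U - X)"
      using XU(1) fX psubset.hyps by (metis card_Diff_subset card_mono le_add_diff_inverse)
    show ?thesis
    proof (cases "card X = k")
      case True
      have "X \<notin> \<P>" using IH(3) XU(2) by blast
      moreover have "disjoint (insert X \<P>)"
        using IH(2,3) unfolding disjoint_def by blast
      ultimately show ?thesis
        using True IH XU cU
        by (intro exI[of _ "insert X \<P>"] exI[of _ I] conjI) (auto simp: disjoint_def)
    next
      case False
      \<comment> \<open>Since \<open>card X < k\<close>, a neighbour outside \<open>X\<close> could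
        be added without exceeding \<open>k\<close>, against the maximality of
        \<open>X\<close>.\<close>
      have nadj: "\<not> E x w" if "x \<in> X" "w \<in> U - X" for x w
      proof
        assume "E x w"
        then have "linked E (X \<union> {w})"
          using linked_Un[OF XU(3) linked_singleton _ _ _ assms(2)] that by blast
        then have "X \<union> {w} \<in> \<C>"
          using that XU fX False by (auto simp: \<C>_def card_insert_if)
        from Xmax[OF this] show False using that fX by simp
      qed
      have unI: "u \<notin> I" using XU IH(4) by auto
      have uI: "\<forall>x\<in>I. \<not> E u x \<and> \<not> E x u"
        using nadj[OF XU(2)] IH(4) assms(2) by (blast dest: sympD)
      have ind: "\<forall>x\<in>insert u I. \<forall>y\<in>insert u I. x \<noteq> y \<longrightarrow> \<not> E x y"
        using IH(5) uI by auto
      \<comment> \<open>The at most \<open>k - 1\<close> vertices of the stuck set are charged to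
        the new independent vertex \<open>u\<close>.\<close>
      have "card X \<le> k - 1" using False XU(4) by linarith
      then have "card U \<le> k * card \<P> + (k - 1) * card (insert u I)"
        using IH(6) cU fI unI by simp
      moreover have "insert u I \<subseteq> U" "\<forall>Y\<in>\<P>. Y \<subseteq> U \<and> card Y = k \<and> linked E Y"
        using IH(3,4) u by blast+
      ultimately show ?thesis
        using IH(1,2) ind by (intro exI[of _ \<P>] exI[of _ "insert u I"]) blast
    qed
  qed
qed

section \<open>Complete minors from branch sets\<close>

text \<open>\<open>f\<close> sends each vertex to the index of its branch set. Induction on the
  number of vertices: while \<open>f\<close> is not injective, some edge lies inside a fibre, and
  contracting it preserves all hypotheses. Once \<open>f\<close> is injective, it is itself the
  isomorphism.\<close>

lemma contracts_to_complete_graph: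
  assumes "simple_graph S" "f ` verts S = {..<r}"
    and "\<And>x y. x \<in> verts S \<Longrightarrow> y \<in> verts S \<Longrightarrow> f x = f y \<Longrightarrow>
      (\<lambda>a b. {a, b} \<in> edges S \<and> f a = f b)\<^sup>*\<^sup>* x y"
    and "\<And>i j. i < r \<Longrightarrow> j < r \<Longrightarrow> i \<noteq> j \<Longrightarrow> \<exists>x y. {x, y} \<in> edges S \<and> f x = i \<and> f y = j"
  shows "\<exists>T. contracts_to\<^sup>*\<^sup>* S T \<and> graph_iso T (complete_graph r)"
  using assms
proof (induction "card (verts S)" arbitrary: S rule: less_induct)
  case less
  have fin: "finite (verts S)" and edg: "edges S \<subseteq> [verts S]\<^bsup>2\<^esup>"
    using less.prems(1) by (auto simp: simple_graph_def)
  show ?case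
  proof (cases "inj_on f (verts S)")
    case True
    have "(\<lambda>e. f ` e) ` edges S = [{..<r}]\<^bsup>2\<^esup>"
    proof (intro equalityI subsetI)
      fix e assume "e \<in> (\<lambda>e. f ` e) ` edges S"
      then obtain e' where e': "e = f ` e'" "e' \<in> [verts S]\<^bsup>2\<^esup>" using edg by auto
      then obtain x y where "e = {f x, f y}" "x \<in> verts S" "y \<in> verts S" "x \<noteq> y"
        by (auto simp: nsets_2_eq)
      then show "e \<in> [{..<r}]\<^bsup>2\<^esup>"
        using True less.prems(2) by (auto simp: inj_on_def)
    next
      fix e assume "e \<in> [{..<r}]\<^bsup>2\<^esup>"
      then obtain i j where "e = {i, j}" "i < r" "j < r" "i \<noteq> j" by (auto simp: nsets_2_eq)
      with less.prems(4)[of i j] obtain x y where "{x, y} \<in> edges S" "e = f ` {x, y}" by auto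
      then show "e \<in> (\<lambda>e. f ` e) ` edges S" by blast
    qed
    then have "graph_iso S (complete_graph r)"
      unfolding graph_iso_def complete_graph_def
      using True less.prems(2) by (intro exI[of _ f]) (auto simp: bij_betw_def)
    then show ?thesis by blast
  next
    case False
    then obtain x y where xy: "x \<in> verts S" "y \<in> verts S" "f x = f y" "x \<noteq> y"
      by (auto simp: inj_on_def)
    \<comment> \<open>The first edge of a walk inside a fibre between two distinct vertices is the
      edge to contract.\<close>
    from less.prems(3)[OF xy(1-3)] obtain v where uv: "{x, v} \<in> edges S" "f x = f v"
      by (cases rule: converse_rtranclpE) (use xy(4) in auto)
    define g where "g = (\<lambda>w. if w = v then x else w)"
    define S' where "S' = contract_edge x v S"
    have xv: "x \<in> verts S" "v \<in> verts S" "x \<noteq> v"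
      using subsetD[OF edg uv(1)] by simp_all
    have S': "verts S' = g ` verts S" "edges S' = {e \<in> (\<lambda>e. g ` e) ` edges S. card e = 2}"
      by (simp_all add: S'_def contract_edge_def g_def Let_def)
    have fg: "f (g w) = f w" for w using uv(2) by (simp add: g_def)
    have vS': "verts S' = verts S - {v}" using xv by (auto simp: S'(1) g_def)
    have gid: "g w = w" if "w \<in> verts S'" for w using that by (auto simp: vS' g_def)
    have edge': "{g a, g b} \<in> edges S'" if "{a, b} \<in> edges S" "g a \<noteq> g b" for a b
      using that by (auto simp: S'(2) intro!: rev_image_eqI[of "{a, b}"])
    have "contracts_to S S'" using uv by (auto simp: contracts_to_def S'_def)
    moreover have "\<exists>T. contracts_to\<^sup>*\<^sup>* S' T \<and> graph_iso T (complete_graph r)"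
    proof (rule less.hyps)
      show "card (verts S') < card (verts S)"
        unfolding vS' using fin xv(2) by (rule card_Diff1_less)
      show "simple_graph S'"
        unfolding simple_graph_def
      proof
        show "edges S' \<subseteq> [verts S']\<^bsup>2\<^esup>"
          using edg by (auto simp: S' nsets_def)
      qed (simp add: vS' fin)
      show "f ` verts S' = {..<r}"
        using less.prems(2) by (simp add: S'(1) image_image fg)
      show "(\<lambda>a b. {a, b} \<in> edges S' \<and> f a = f b)\<^sup>*\<^sup>* a b"
        if ab: "a \<in> verts S'" "b \<in> verts S'" "f a = f b" for a b
      proof -
        have "(\<lambda>a b. {a, b} \<in> edges S \<and> f a = f b)\<^sup>*\<^sup>* a b"
          using less.prems(3) ab by (simp add: vS')
        \<comment> \<open>The walk is pushed through \<open>g\<close>; a step whose ends are merged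
          collapses and is dropped.\<close>
        then have "(\<lambda>a b. {a, b} \<in> edges S' \<and> f a = f b)\<^sup>*\<^sup>* (g a) (g b)"
        proof (induction rule: rtranclp_induct)
          case (step c d)
          show ?case
          proof (cases "g c = g d")
            case False
            then have "{g c, g d} \<in> edges S' \<and> f (g c) = f (g d)" using edge' step.hyps fg by simp
            with step.IH show ?thesis by (rule rtranclp.rtrancl_into_rtrancl)
          qed (use step in simp)
        qed simp
        then show ?thesis using ab gid by simp
      qed
      show "\<exists>x y. {x, y} \<in> edges S' \<and> f x = i \<and> f y = j" if ij: "i < r" "j < r" "i \<noteq> j" for i j
      proof -
        obtain a b where "{a, b} \<in> edges S" "f a = i" "f b = j"
          using less.prems(4)[OF ij] by blast
        moreover then have "g a \<noteq> g b" using ij fg[of a] fg[of b] by auto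
        ultimately show ?thesis using edge'[of a b] fg[of a] fg[of b] by blast
      qed
    qed
    ultimately show ?thesis by (meson converse_rtranclp_into_rtranclp)
  qed
qed

text \<open>Contraction takes place in the subgraph induced on the union of the branch sets, with
  \<open>f\<close> reading off the branch set of a vertex. Disjointness makes \<open>f\<close> well
  defined.\<close>

lemma is_minor_complete_graphI:
  assumes K: "simple_graph K" and disj: "disjoint_family_on B {..<r}"
    and B: "\<And>j. j < r \<Longrightarrow> B j \<noteq> {} \<and> B j \<subseteq> verts K \<and> linked (\<lambda>x y. {x, y} \<in> edges K) (B j)"
    and adj: "\<And>i j. i < j \<Longrightarrow> j < r \<Longrightarrow> \<exists>x\<in>B i. \<exists>y\<in>B j. {x, y} \<in> edges K"
  shows "is_minor (complete_graph r) K"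
proof -
  define W where "W = (\<Union>j<r. B j)"
  define S where "S = (W, {e \<in> edges K. e \<subseteq> W})"
  define f where "f = (\<lambda>v. THE j. j < r \<and> v \<in> B j)"
  have f: "f v = j" if "v \<in> B j" "j < r" for v j
    unfolding f_def using that disj by (intro the_equality) (auto simp: disjoint_family_on_def)
  have WK: "W \<subseteq> verts K" using B by (auto simp: W_def)
  have S: "simple_graph S"
    using K finite_subset[OF WK] by (auto simp: simple_graph_def S_def nsets_def)
  then have "subgraph S K" using WK by (auto simp: subgraph_def S_def)
  moreover have "\<exists>T. contracts_to\<^sup>*\<^sup>* S T \<and> graph_iso T (complete_graph r)"
  proof (rule contracts_to_complete_graph[where f = f])
    show "simple_graph S" by (rule S)
    show "f ` verts S = {..<r}"
    proof (intro equalityI subsetI)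
      fix j assume "j \<in> {..<r}"
      moreover then obtain v where "v \<in> B j" using B by auto
      ultimately show "j \<in> f ` verts S" using f by (force simp: S_def W_def)
    qed (use f in \<open>auto simp: S_def W_def\<close>)
    show "(\<lambda>a b. {a, b} \<in> edges S \<and> f a = f b)\<^sup>*\<^sup>* x y"
      if xy: "x \<in> verts S" "y \<in> verts S" "f x = f y" for x y
    proof -
      obtain i j where "i < r" "x \<in> B i" "j < r" "y \<in> B j"
        using xy by (auto simp: S_def W_def)
      moreover then have "i = j" using f xy(3) by metis
      ultimately have j: "j < r" "x \<in> B j" "y \<in> B j" by auto
      then have "(\<lambda>a b. a \<in> B j \<and> b \<in> B j \<and> {a, b} \<in> edges K)\<^sup>*\<^sup>* x y"
        using B by (auto simp: linked_def)
      then show ?thesis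
        by (rule rtranclp_mono[THEN predicate2D, rotated]) (use f j in \<open>auto simp: S_def W_def\<close>)
    qed
    show "\<exists>x y. {x, y} \<in> edges S \<and> f x = i \<and> f y = j" if ij: "i < r" "j < r" "i \<noteq> j" for i j
    proof -
      have *: "\<exists>x\<in>B i. \<exists>y\<in>B j. {x, y} \<in> edges K"
        
      proof (cases "i < j")
        case False
        then obtain x y where "x \<in> B j" "y \<in> B i" "{x, y} \<in> edges K"
          using adj[of j i] ij by auto
        moreover then have "{y, x} \<in> edges K" by (simp add: insert_commute)
        ultimately show ?thesis by blast
      qed (use adj ij in blast)
      then obtain x y where "x \<in> B i" "y \<in> B j" "{x, y} \<in> edges K" by auto
      then show ?thesis using f ij by (intro exI[of _ x] exI[of _ y]) (auto simp: S_def W_def)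
    qed
  qed
  ultimately show ?thesis unfolding is_minor_def by blast
qed

section \<open>Long paths\<close>

text \<open>
  The depth-first search of Ben-Eliezer, Krivelevich and Sudakov: a step either moves an unvisited
  vertex of \<open>T\<close> to the current path or retires the end of the path to \<open>S\<close>, so the difference
  of the sizes of \<open>T\<close> and \<open>S\<close> drops by one per step and vanishes at some point.
\<close>

lemma dfs_state:
  assumes "finite V" "symp E" "j \<le> card V"
  shows "\<exists>S T xs. S \<union> T \<union> set xs = V \<and> S \<inter> T = {} \<and> S \<inter> set xs = {} \<and> T \<inter> set xs = {} \<and>
    distinct xs \<and> successively E xs \<and> (\<forall>x\<in>S. \<forall>y\<in>T. \<not> E x y) \<and>
    card T = card S + (card V - j)"
  using assms(3)
proof (induction j)
  case 0
  show ?case by (rule exI[of _ "{}"], rule exI[of _ V], rule exI[of _ "[]"]) simp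
next
  case (Suc j)
  then obtain S T xs where st: "S \<union> T \<union> set xs = V" "S \<inter> T = {}" "S \<inter> set xs = {}" "T \<inter> set xs = {}"
    "distinct xs" "successively E xs" "\<forall>x\<in>S. \<forall>y\<in>T. \<not> E x y" "card T = card S + (card V - j)"
    by auto
  have fin: "finite S" "finite T" using st(1) assms(1) by (metis finite_Un)+
  \<comment> \<open>The end of the path at which the search acts is the head of \<open>xs\<close>,
    so moving a vertex onto the path is a \<open>Cons\<close>.\<close>
  have extend: ?case if t: "t \<in> T" "successively E (t # xs)" for t
    by (rule exI[of _ S], rule exI[of _ "T - {t}"], rule exI[of _ "t # xs"])
       (use st t fin Suc.prems in auto)
  show ?case
  proof (cases xs)
    case Nil
    have "card T > 0" using st(8) Suc.prems by linarith
    then obtain t where "t \<in> T" by (metis card_gt_0_iff ex_in_conv)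
    then show ?thesis using extend Nil by simp
  next
    case (Cons x ys)
    show ?thesis
    proof (cases "\<exists>t\<in>T. E x t")
      case True
      then show ?thesis using extend Cons st(6) assms(2) by (auto dest: sympD)
    next
      \<comment> \<open>No neighbour of \<open>x\<close> is left in \<open>T\<close>, so retiring
        \<open>x\<close> to \<open>S\<close> creates no edge between \<open>S\<close> and
        \<open>T\<close>.\<close>
      case False
      show ?thesis
        by (rule exI[of _ "insert x S"], rule exI[of _ T], rule exI[of _ ys])
           (use st Cons False fin Suc.prems in \<open>auto simp: successively_Cons\<close>)
    qed
  qed
qed

text \<open>After \<open>card V\<close> search steps \<open>S\<close> and \<open>T\<close> have
  equal size and no edges between them. Hence both have fewer than \<open>m\<close> elements, and
  all remaining vertices lie on the path.\<close>

lemma long_path: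
  assumes "finite V" "symp E" "m > 0"
    and "\<And>A B. A \<subseteq> V \<Longrightarrow> B \<subseteq> V \<Longrightarrow> A \<inter> B = {} \<Longrightarrow> card A = m \<Longrightarrow> card B = m \<Longrightarrow> \<exists>x\<in>A. \<exists>y\<in>B. E x y"
  shows "\<exists>xs. distinct xs \<and> set xs \<subseteq> V \<and> successively E xs \<and> card V \<le> length xs + 2 * (m - 1)"
proof -
  obtain S T xs where st: "S \<union> T \<union> set xs = V" "S \<inter> T = {}" "S \<inter> set xs = {}" "T \<inter> set xs = {}"
    "distinct xs" "successively E xs" "\<forall>x\<in>S. \<forall>y\<in>T. \<not> E x y" "card T = card S"
    using dfs_state[OF assms(1,2) order_refl] by auto
  have fin: "finite S" "finite T" using st(1) assms(1) by (metis finite_Un)+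
  have "card S < m"
  proof (rule ccontr)
    assume "\<not> card S < m"
    then obtain A B where "A \<subseteq> S" "card A = m" "B \<subseteq> T" "card B = m"
      using st(8) obtain_subset_with_card_n by (metis not_less)
    then show False using assms(4)[of A B] st(1,2,7) by blast
  qed
  moreover have "card V = card S + card T + length xs"
  proof -
    have "card (S \<union> T \<union> set xs) = card (S \<union> T) + card (set xs)"
      using st fin by (intro card_Un_disjoint) auto
    moreover have "card (S \<union> T) = card S + card T"
      using st fin by (intro card_Un_disjoint) auto
    ultimately show ?thesis using st(1,5) by (simp add: distinct_card)
  qed
  ultimately show ?thesis using st by (intro exI[of _ xs]) auto
qed

section \<open>Uniformly random vertex orders\<close>

text \<open>
  Under a uniformly random permutation the next value is uniform among the unused ones: composing
  with the transposition of \<open>z\<close> and \<open>y\<close> turns \<open>p y\<close> into \<open>p z\<close> without affecting \<open>zs\<close>.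
\<close>

lemma sum_permutations_snoc:
  fixes F :: "'a list \<Rightarrow> 'a \<Rightarrow> 'b::comm_semiring_1"
  assumes "finite V" "distinct zs" "set zs \<subseteq> V" "z \<in> V" "z \<notin> set zs"
  shows "(\<Sum>p | p permutes V. \<Sum>w \<in> V - p ` set zs. F (map p zs) w) =
    of_nat (card V - length zs) * (\<Sum>p | p permutes V. F (map p zs) (p z))"
proof -
  have "(\<Sum>w \<in> V - p ` set zs. F (map p zs) w) = (\<Sum>y \<in> V - set zs. F (map p zs) (p y))"
    if "p permutes V" for p
  proof -
    have "V - p ` set zs = p ` (V - set zs)"
      using that by (metis image_set_diff permutes_image permutes_inj)
    then show ?thesis
      using permutes_inj_on[OF that] by (simp add: sum.reindex)
  qed
  then have "(\<Sum>p | p permutes V. \<Sum>w \<in> V - p ` set zs. F (map p zs) w) =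
      (\<Sum>y \<in> V - set zs. \<Sum>p | p permutes V. F (map p zs) (p y))"
    by (simp add: sum.swap[of _ "V - set zs"])
  also have "\<dots> = (\<Sum>y \<in> V - set zs. \<Sum>p | p permutes V. F (map p zs) (p z))"
  proof (rule sum.cong[OF refl])
    fix y assume y: "y \<in> V - set zs"
    have t: "Transposition.transpose z y permutes V" using y assms(4) by (intro permutes_swap_id) auto
    have "(\<Sum>p | p permutes V. F (map p zs) (p y)) =
        (\<Sum>p | p permutes V. F (map (p \<circ> Transposition.transpose z y) zs) ((p \<circ> Transposition.transpose z y) y))"
      by (rule sum_permutations_compose_right[OF t])
    also have "\<dots> = (\<Sum>p | p permutes V. F (map p zs) (p z))"
    proof (rule sum.cong[OF refl])
      fix p :: "'a \<Rightarrow> 'a"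
      have "map (p \<circ> Transposition.transpose z y) zs = map p zs"
        using y assms(5) by (intro map_cong) (auto simp: Transposition.transpose_def)
      then show "F (map (p \<circ> Transposition.transpose z y) zs) ((p \<circ> Transposition.transpose z y) y) = F (map p zs) (p z)"
        by (simp only: comp_apply transpose_apply_second)
    qed
    finally show "(\<Sum>p | p permutes V. F (map p zs) (p y)) =
      (\<Sum>p | p permutes V. F (map p zs) (p z))" .
  qed
  also have "\<dots> = of_nat (card V - length zs) * (\<Sum>p | p permutes V. F (map p zs) (p z))"
    using assms by (simp add: card_Diff_subset distinct_card)
  finally show ?thesis .
qed

text \<open>The vertices that a segment placed on \<open>A\<close> does not see. Two disjoint
  segments are nonadjacent exactly when the second falls entirely into this set.\<close>

definition nonnbrs :: "'a set \<Rightarrow> ('a \<Rightarrow> 'a \<Rightarrow> bool) \<Rightarrow> 'a set \<Rightarrow> 'a set" where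
  "nonnbrs V H A = {v \<in> V. \<forall>a\<in>A. v \<noteq> a \<and> \<not> H a v}"

lemma nonnbrs_insert: "nonnbrs V H (insert w A) = nonnbrs V H A - {v. v = w \<or> H w v}"
  by (auto simp: nonnbrs_def)

lemma nonnbrs_subset: "nonnbrs V H A \<subseteq> V - A"
  by (auto simp: nonnbrs_def)

text \<open>A maximal independent set of low-degree vertices dominates all of them.\<close>

lemma card_low_degree_le:
  fixes a d :: real
  assumes "finite U" "symp H"
    and ind: "\<And>I. I \<subseteq> U \<Longrightarrow> (\<forall>x\<in>I. \<forall>y\<in>I. x \<noteq> y \<longrightarrow> \<not> H x y) \<Longrightarrow> real (card I) \<le> a"
    and "d \<ge> 0"
  shows "card {w \<in> U. card {v \<in> U. v = w \<or> H w v} < d} \<le> a * d"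
proof -
  define W where "W = {w \<in> U. card {v \<in> U. v = w \<or> H w v} < d}"
  have "finite W" "W \<subseteq> U" using assms(1) by (auto simp: W_def)
  define \<I> where "\<I> = {I. I \<subseteq> W \<and> (\<forall>x\<in>I. \<forall>y\<in>I. x \<noteq> y \<longrightarrow> \<not> H x y)}"
  have "finite \<I>" using \<open>finite W\<close> by (simp add: \<I>_def)
  moreover have "{} \<in> \<I>" by (simp add: \<I>_def)
  ultimately obtain I where I: "I \<in> \<I>" and max: "\<And>J. J \<in> \<I> \<Longrightarrow> I \<subseteq> J \<Longrightarrow> J = I"
    using finite_has_maximal[of \<I>] by blast
  have IW: "I \<subseteq> W" using I by (auto simp: \<I>_def)
  then have fI: "finite I" using \<open>finite W\<close> finite_subset by blast
  have "W \<subseteq> (\<Union>w\<in>I. {v \<in> U. v = w \<or> H w v})"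
  proof
    fix v assume v: "v \<in> W"
    show "v \<in> (\<Union>w\<in>I. {v \<in> U. v = w \<or> H w v})"
    proof (rule ccontr)
      assume "\<not> ?thesis"
      then have n: "v \<notin> I" "\<forall>w\<in>I. \<not> H w v \<and> \<not> H v w"
        using v \<open>W \<subseteq> U\<close> assms(2) by (auto dest: sympD)
      then have "insert v I \<in> \<I>" using I v by (auto simp: \<I>_def)
      with max n(1) show False by blast
    qed
  qed
  then have "card W \<le> card (\<Union>w\<in>I. {v \<in> U. v = w \<or> H w v})"
    using fI assms(1) by (intro card_mono) auto
  also have "\<dots> \<le> (\<Sum>w\<in>I. card {v \<in> U. v = w \<or> H w v})"
    using fI by (rule card_UN_le)
  finally have "real (card W) \<le> real (\<Sum>w\<in>I. card {v \<in> U. v = w \<or> H w v})"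
    by (simp only: of_nat_le_iff)
  also have "\<dots> \<le> (\<Sum>w\<in>I. d)"
    unfolding of_nat_sum
    using IW by (intro sum_mono) (auto simp: W_def)
  also have "\<dots> = card I * d" by simp
  also have "\<dots> \<le> a * d"
    using ind[of I] I \<open>W \<subseteq> U\<close> IW \<open>d \<ge> 0\<close> by (intro mult_right_mono) (auto simp: \<I>_def)
  finally show ?thesis unfolding W_def .
qed

section \<open>Exponential moments of the unseen set under a random order\<close>

locale random_order =
  fixes V :: "'a set" and H :: "'a \<Rightarrow> 'a \<Rightarrow> bool" and a \<theta> :: real
  assumes fin: "finite V" and sym: "symp H" and a: "a > 0" and theta: "\<theta> > 0"
    and ind: "\<And>I. I \<subseteq> V \<Longrightarrow> (\<forall>x\<in>I. \<forall>y\<in>I. x \<noteq> y \<longrightarrow> \<not> H x y) \<Longrightarrow> real (card I) \<le> a"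
begin

abbreviation N :: nat where "N \<equiv> card V"

abbreviation U :: "'a set \<Rightarrow> 'a set" where "U \<equiv> nonnbrs V H"

text \<open>Upper bound for the average factor by which \<open>\<Phi>\<close> changes per exposed
  vertex: at least a quarter of the choices lower \<open>card (U A)\<close> by
  \<open>N / (4 * a)\<close> or more, and the others do not raise it.\<close>

definition \<gamma> :: real where "\<gamma> = 3 / 4 + exp (- \<theta> * (N / (4 * a))) / 4"

text \<open>
  Above the cutoff, at least a quarter of all vertices have \<open>N / (4 * a)\<close> neighbours inside \<open>U A\<close>.
\<close>

definition \<Phi> :: "'a set \<Rightarrow> real" where
  "\<Phi> A = (if real (card (U A)) < N / 2 then 0 else exp (\<theta> * card (U A)))"

lemma fin_U: "finite (U A)"
  using nonnbrs_subset[of V H A] fin finite_subset by blast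

text \<open>Averaging over the next vertex \<open>w\<close>. At most \<open>a * d = N / 4\<close>
  vertices of \<open>U A\<close> have low degree there, so at least \<open>N / 4\<close> of them
  gain a factor \<open>exp (- \<theta> * d)\<close>; no other choice increases
  \<open>\<Phi>\<close>. Below the cutoff both sides vanish, as \<open>U\<close> only
  shrinks.\<close>

lemma \<Phi>_step:
  assumes "A \<subseteq> V" "A \<noteq> V"
  shows "(\<Sum>w\<in>V - A. \<Phi> (insert w A)) \<le> card (V - A) * (\<gamma> * \<Phi> A)"
proof (cases "real (card (U A)) < N / 2")
  case True
  have "\<Phi> (insert w A) = 0" for w
  proof -
    have "card (U (insert w A)) \<le> card (U A)"
      by (intro card_mono fin_U) (auto simp: nonnbrs_insert)
    then show ?thesis using True by (simp add: \<Phi>_def)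
  qed
  then show ?thesis using True by (simp add: \<Phi>_def)
next
  case False
  define d where "d = N / (4 * a)"
  define D where "D w = {v \<in> U A. v = w \<or> H w v}" for w
  define Lo where "Lo = {w \<in> U A. card (D w) < d}"
  define M where "M = card (V - A)"
  have d0: "d \<ge> 0" using a by (simp add: d_def)
  have "real (card Lo) \<le> a * d"
    unfolding Lo_def D_def
  proof (rule card_low_degree_le[OF fin_U sym _ d0])
    fix I assume I: "I \<subseteq> U A" "\<forall>x\<in>I. \<forall>y\<in>I. x \<noteq> y \<longrightarrow> \<not> H x y"
    have "I \<subseteq> V" using I(1) nonnbrs_subset[of V H A] by blast
    then show "real (card I) \<le> a" using I(2) by (rule ind)
  qed
  also have "a * d = N / 4" using a by (simp add: d_def)
  finally have Lo: "real (card Lo) \<le> N / 4" .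
  define Hi where "Hi = U A - Lo"
  have "real (card Hi) = real (card (U A)) - real (card Lo)"
    unfolding Hi_def using fin_U by (subst card_Diff_subset) (auto simp: Lo_def of_nat_diff card_mono finite_subset)
  with Lo False have Hi: "real (card Hi) \<ge> N / 4" by linarith
  have HiV: "Hi \<subseteq> V - A" using nonnbrs_subset[of V H A] by (auto simp: Hi_def)
  have "M \<le> N" unfolding M_def using fin by (intro card_mono) auto
  define P where "P = exp (\<theta> * card (U A))"
  have P: "\<Phi> A = P" using False by (simp add: \<Phi>_def P_def)
  have cardU: "card (U (insert w A)) = real (card (U A)) - card (D w)" for w
  proof -
    have "U (insert w A) = U A - D w" by (auto simp: nonnbrs_insert D_def)
    then show ?thesis
      using fin_U by (simp add: card_Diff_subset D_def of_nat_diff card_mono)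
  qed
  have le: "\<Phi> (insert w A) \<le> P" for w
    using theta by (auto simp: \<Phi>_def P_def cardU)
  have le': "\<Phi> (insert w A) \<le> P * exp (- \<theta> * d)" if "w \<in> Hi" for w
  proof -
    have "d \<le> card (D w)" using that by (auto simp: Hi_def Lo_def)
    then have "\<theta> * d \<le> \<theta> * card (D w)" using theta by simp
    then have "exp (\<theta> * (real (card (U A)) - card (D w))) \<le> P * exp (- \<theta> * d)"
      by (simp add: P_def algebra_simps flip: exp_add)
    then show ?thesis by (auto simp: \<Phi>_def cardU P_def)
  qed
  have "(\<Sum>w\<in>V - A. \<Phi> (insert w A)) = (\<Sum>w\<in>V - A - Hi. \<Phi> (insert w A)) + (\<Sum>w\<in>Hi. \<Phi> (insert w A))"
    using HiV fin by (intro sum.subset_diff) auto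
  also have "\<dots> \<le> (\<Sum>w\<in>V - A - Hi. P) + (\<Sum>w\<in>Hi. P * exp (- \<theta> * d))"
    using le le' by (intro add_mono sum_mono) auto
  also have "\<dots> = (real M - card Hi) * P + card Hi * (P * exp (- \<theta> * d))"
    using HiV fin finite_subset[OF HiV] by (simp add: card_Diff_subset M_def of_nat_diff card_mono)
  also have "\<dots> = P * (M - card Hi * (1 - exp (- \<theta> * d)))" by (simp add: algebra_simps)
  also have "\<dots> \<le> P * (M - M / 4 * (1 - exp (- \<theta> * d)))"
    using Hi \<open>M \<le> N\<close> theta d0
    by (intro mult_left_mono diff_left_mono mult_right_mono) (auto simp: P_def)
  also have "\<dots> = M * (\<gamma> * \<Phi> A)" by (simp add: P \<gamma>_def d_def algebra_simps)
  finally show ?thesis by (simp add: M_def)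
qed

lemma \<gamma>_pos: "\<gamma> > 0"
  unfolding \<gamma>_def by (intro add_pos_pos) auto

lemma sum_\<Phi>_le:
  assumes "distinct xs" "set xs \<subseteq> V"
  shows "(\<Sum>p | p permutes V. \<Phi> (p ` set xs)) \<le> fact N * (\<gamma> ^ length xs * exp (\<theta> * N))"
  using assms
proof (induction xs rule: rev_induct)
  case Nil
  have "\<Phi> {} \<le> exp (\<theta> * N)" by (simp add: \<Phi>_def nonnbrs_def)
  then show ?case using fin by (simp add: card_permutations)
next
  case (snoc z zs)
  define M where "M = card V - length zs"
  have z: "distinct zs" "set zs \<subseteq> V" "z \<in> V" "z \<notin> set zs" using snoc.prems by auto
  have lz: "length zs < card V"
    using z fin by (metis distinct_card psubsetI psubset_card_mono)
  then have M: "real M > 0" by (simp add: M_def)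
  have "M * (\<Sum>p | p permutes V. \<Phi> (p ` set (zs @ [z]))) =
      (\<Sum>p | p permutes V. \<Sum>w \<in> V - p ` set zs. \<Phi> (insert w (p ` set zs)))"
    using sum_permutations_snoc[OF fin z, of "\<lambda>ys w. \<Phi> (insert w (set ys))"] by (simp add: M_def)
  also have "\<dots> \<le> (\<Sum>p | p permutes V. M * (\<gamma> * \<Phi> (p ` set zs)))"
  proof (rule sum_mono)
    fix p assume "p \<in> {p. p permutes V}"
    then have p: "p permutes V" by simp
    have sub: "p ` set zs \<subseteq> V" using z(2) permutes_image[OF p] by blast
    have c: "card (p ` set zs) = length zs"
      using z(1) permutes_inj_on[OF p] by (simp add: card_image distinct_card)
    then have "p ` set zs \<noteq> V" using lz by auto
    moreover have "card (V - p ` set zs) = M"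
      using sub c fin by (simp add: M_def card_Diff_subset finite_subset)
    ultimately show "(\<Sum>w \<in> V - p ` set zs. \<Phi> (insert w (p ` set zs))) \<le> M * (\<gamma> * \<Phi> (p ` set zs))"
      using \<Phi>_step[OF sub] by simp
  qed
  also have "\<dots> = M * (\<gamma> * (\<Sum>p | p permutes V. \<Phi> (p ` set zs)))"
    by (simp add: sum_distrib_left)
  finally have "(\<Sum>p | p permutes V. \<Phi> (p ` set (zs @ [z]))) \<le> \<gamma> * (\<Sum>p | p permutes V. \<Phi> (p ` set zs))"
    using M mult_le_cancel_left_pos by blast
  also have "\<dots> \<le> \<gamma> * (fact N * (\<gamma> ^ length zs * exp (\<theta> * N)))"
    using snoc.IH z \<gamma>_pos by (intro mult_left_mono) auto
  finally show ?case by (simp add: mult_ac)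
qed

text \<open>With \<open>xs\<close> placed, the elements of \<open>ys\<close> are drawn one after
  another without replacement, and each falls into the unseen set with probability at most its
  initial density. The arbitrary weight \<open>g\<close> lets the induction absorb one factor per
  element.\<close>

lemma sum_avoid_le:
  fixes g :: "'a set \<Rightarrow> real"
  assumes "distinct (xs @ ys)" "set (xs @ ys) \<subseteq> V" "\<And>A. g A \<ge> 0"
  shows "(\<Sum>p | p permutes V. g (p ` set xs) * of_bool (p ` set ys \<subseteq> U (p ` set xs))) \<le>
    (\<Sum>p | p permutes V. g (p ` set xs) * (card (U (p ` set xs)) / (real N - length xs)) ^ length ys)"
  using assms
proof (induction ys arbitrary: g rule: rev_induct)
  case (snoc z zs)
  define M where "M = card V - length (xs @ zs)"
  define K where "K = real N - length xs"
  have z: "distinct (xs @ zs)" "set (xs @ zs) \<subseteq> V" "z \<in> V" "z \<notin> set (xs @ zs)" using snoc.prems by auto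
  have lz: "length (xs @ zs) < card V"
    using z fin by (metis distinct_card psubsetI psubset_card_mono)
  then have M: "real M > 0" "real M = K - length zs" by (auto simp: M_def K_def)
  define q where "q A = card (U A) / K" for A
  let ?c = "\<lambda>p. g (p ` set xs) * of_bool (p ` set zs \<subseteq> U (p ` set xs))"
  \<comment> \<open>The exchange lemma passes on a single list of all earlier images;
    \<open>take\<close> and \<open>drop\<close> recover the two parts from it.\<close>
  have take: "take (length xs) (map p (xs @ zs)) = map p xs" "drop (length xs) (map p (xs @ zs)) = map p zs" for p :: "'a \<Rightarrow> 'a"
    by auto
  have "M * (\<Sum>p | p permutes V. g (p ` set xs) * of_bool (p ` set (zs @ [z]) \<subseteq> U (p ` set xs))) =
     (\<Sum>p | p permutes V. \<Sum>w \<in> V - p ` set (xs @ zs). ?c p * of_bool (w \<in> U (p ` set xs)))"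
    using sum_permutations_snoc[OF fin z, of "\<lambda>ys w. g (set (take (length xs) ys)) *
      of_bool (set (drop (length xs) ys) \<subseteq> U (set (take (length xs) ys))) *
      of_bool (w \<in> U (set (take (length xs) ys)))"]
    by (simp add: M_def mult.assoc conj_commute flip: of_bool_conj)
  also have "\<dots> \<le> (\<Sum>p | p permutes V. M * (?c p * q (p ` set xs)))"
  proof (rule sum_mono)
    fix p assume "p \<in> {p. p permutes V}"
    then have p: "p permutes V" by simp
    let ?A = "p ` set xs" and ?B = "p ` set zs"
    have cA: "card ?A = length xs" and cB: "card ?B = length zs"
      using z(1) permutes_inj_on[OF p] by (simp_all add: card_image distinct_card)
    have subA: "?A \<subseteq> V" using z(2) permutes_image[OF p] by auto
    have uK: "card (U ?A) \<le> K"
    proof -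
      have "card (U ?A) \<le> card (V - ?A)" using fin by (intro card_mono nonnbrs_subset) auto
      also have "card (V - ?A) = N - length xs" using subA cA by (simp add: card_Diff_subset)
      finally show ?thesis using lz by (simp add: K_def)
    qed
    show "(\<Sum>w \<in> V - p ` set (xs @ zs). ?c p * of_bool (w \<in> U ?A)) \<le> M * (?c p * q ?A)"
    proof (cases "?B \<subseteq> U ?A")
      case True
      have "(V - p ` set (xs @ zs)) \<inter> U ?A = U ?A - ?B"
        using nonnbrs_subset[of V H ?A] by auto
      then have "(\<Sum>w \<in> V - p ` set (xs @ zs). of_bool (w \<in> U ?A)) = real (card (U ?A - ?B))"
        using fin by (simp add: of_bool_def sum.If_cases Int_def)
      also have "\<dots> = real (card (U ?A)) - length zs"
        using True fin_U cB by (simp add: card_Diff_subset of_nat_diff card_mono flip: cB)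
      \<comment> \<open>With \<open>u = card (U ?A)\<close> and \<open>j = length zs\<close> this is
        \<open>(u - j) / (K - j) \<le> u / K\<close>, which holds since
        \<open>u \<le> K\<close>.\<close>
      also have "\<dots> \<le> M * q ?A"
      proof -
        have "K > 0" using M by linarith
        moreover have "K * (real (card (U ?A)) - length zs) \<le> M * card (U ?A)"
          using mult_right_mono[OF uK, of "length zs"] by (simp add: M(2) algebra_simps)
        ultimately show ?thesis by (simp add: q_def field_simps)
      qed
      finally have "(\<Sum>w \<in> V - p ` set (xs @ zs). of_bool (w \<in> U ?A)) \<le> M * q ?A" .
      from mult_left_mono[OF this snoc.prems(3)[of ?A]] show ?thesis
        using True by (simp add: mult.left_commute flip: sum_distrib_left)
    qed simp
  qed
  also have "\<dots> = M * (\<Sum>p | p permutes V. ?c p * q (p ` set xs))"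
    by (simp add: sum_distrib_left)
  finally have "(\<Sum>p | p permutes V. g (p ` set xs) * of_bool (p ` set (zs @ [z]) \<subseteq> U (p ` set xs)))
      \<le> (\<Sum>p | p permutes V. ?c p * q (p ` set xs))"
    using M(1) mult_le_cancel_left_pos by blast
  also have "\<dots> \<le> (\<Sum>p | p permutes V. (g (p ` set xs) * q (p ` set xs)) * q (p ` set xs) ^ length zs)"
    using snoc.IH[of "\<lambda>A. g A * q A"] z snoc.prems(3) M
    by (simp add: q_def K_def mult_ac)
  finally show ?case by (simp add: q_def K_def mult_ac)
qed simp

text \<open>By \<open>x \<le> exp (x - 1)\<close> the power from \<open>sum_avoid_le\<close> is at
  most \<open>exp (- s) * exp (\<theta> * u)\<close> with \<open>u\<close> the size of the unseen
  set; this dictates the choice of \<open>\<theta>\<close>. The second summand pays for the cutoff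
  in \<open>\<Phi>\<close>.\<close>

lemma card_nonadjacent_le:
  assumes "distinct (xs @ ys)" "set (xs @ ys) \<subseteq> V" "length xs = s" "length ys = s" "s > 0"
    and \<theta>: "\<theta> = s / (real N - s)"
  shows "real (card {p. p permutes V \<and> (\<forall>x\<in>set xs. \<forall>y\<in>set ys. \<not> H (p x) (p y))}) \<le>
    fact N * (exp (- s) * (\<gamma> ^ s * exp (\<theta> * N) + exp (\<theta> * N / 2)))"
proof -
  have "length (xs @ ys) \<le> N"
    using assms(1,2) fin by (metis card_mono distinct_card)
  then have sN: "real s < N" using assms(3-5) by simp
  have "real (card {p. p permutes V \<and> (\<forall>x\<in>set xs. \<forall>y\<in>set ys. \<not> H (p x) (p y))}) =
      (\<Sum>p | p permutes V. 1 * of_bool (p ` set ys \<subseteq> U (p ` set xs)))"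
  proof -
    have "{p. p permutes V \<and> (\<forall>x\<in>set xs. \<forall>y\<in>set ys. \<not> H (p x) (p y))} =
       {p. p permutes V} \<inter> {p. p ` set ys \<subseteq> U (p ` set xs)}" (is "?L = ?R")
    proof (rule set_eqI)
      fix p
      show "p \<in> ?L \<longleftrightarrow> p \<in> ?R"
      proof (cases "p permutes V")
        case True
        then have "p y \<in> V" if "y \<in> set ys" for y
          using that assms(2) by (auto simp: permutes_in_image)
        moreover have "p y \<noteq> p x" if "y \<in> set ys" "x \<in> set xs" for x y
          using that assms(1) permutes_inj[OF True] by (auto dest: injD)
        ultimately show ?thesis using True by (auto simp: nonnbrs_def image_subset_iff)
      qed simp
    qed
    then show ?thesis using fin by (simp add: of_bool_def sum.If_cases finite_permutations)
  qed
  also have "\<dots> \<le> (\<Sum>p | p permutes V. 1 * (card (U (p ` set xs)) / (real N - length xs)) ^ length ys)"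
    by (rule sum_avoid_le) (use assms in auto)
  also have "\<dots> \<le> (\<Sum>p | p permutes V. exp (- s) * (\<Phi> (p ` set xs) + exp (\<theta> * N / 2)))"
  proof (rule sum_mono)
    fix p
    let ?u = "card (U (p ` set xs))"
    have "?u / (real N - s) \<le> exp (?u / (real N - s) - 1)"
      using exp_ge_add_one_self[of "?u / (real N - s) - 1"] by simp
    then have "(?u / (real N - s)) ^ s \<le> exp (?u / (real N - s) - 1) ^ s"
      using sN by (intro power_mono) auto
    also have "\<dots> = exp (- s) * exp (\<theta> * ?u)"
      by (simp add: \<theta> algebra_simps diff_divide_distrib flip: exp_of_nat_mult exp_add)
    also have "exp (\<theta> * ?u) \<le> \<Phi> (p ` set xs) + exp (\<theta> * N / 2)"
    proof (cases "real ?u < N / 2")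
      case True
      then have "\<theta> * ?u \<le> \<theta> * (N / 2)" using theta by (intro mult_left_mono) auto
      then show ?thesis using True by (simp add: \<Phi>_def)
    qed (simp add: \<Phi>_def)
    finally show "1 * (?u / (real N - length xs)) ^ length ys \<le> exp (- s) * (\<Phi> (p ` set xs) + exp (\<theta> * N / 2))"
      using assms(3,4) by simp
  qed
  also have "\<dots> = exp (- s) * ((\<Sum>p | p permutes V. \<Phi> (p ` set xs)) + fact N * exp (\<theta> * N / 2))"
    using fin by (simp add: sum_distrib_left[symmetric] sum.distrib card_permutations)
  also have "\<dots> \<le> exp (- s) * (fact N * (\<gamma> ^ s * exp (\<theta> * N)) + fact N * exp (\<theta> * N / 2))"
    using sum_\<Phi>_le[of xs] assms(1-3) by auto
  finally show ?thesis by (simp add: algebra_simps)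
qed

end

text \<open>
  As \<open>\<theta> * N = s + s\<^sup>2 / (N - s)\<close>, the factor \<open>exp (- s)\<close> of the previous bound cancels the main
  term of \<open>exp (\<theta> * N)\<close>, and the gain from \<open>\<gamma> ^ s\<close> exceeds the rest because \<open>a\<close> and \<open>s\<close> are small.
\<close>

lemma card_nonadjacent_permutations_le:
  fixes a :: real and s :: nat
  assumes fin: "finite V" and sym: "symp H" and a: "a > 0"
    and ind: "\<And>I. I \<subseteq> V \<Longrightarrow> (\<forall>x\<in>I. \<forall>y\<in>I. x \<noteq> y \<longrightarrow> \<not> H x y) \<Longrightarrow> real (card I) \<le> a"
    and xs: "distinct (xs @ ys)" "set (xs @ ys) \<subseteq> V" "length xs = s" "length ys = s" "s > 0"
    and aN: "a \<le> card V / 80" and sN: "s \<le> card V / 20"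
    and L: "L \<le> s / 16" "L \<le> s\<^sup>2 / (64 * a)"
  shows "real (card {p. p permutes V \<and> (\<forall>x\<in>set xs. \<forall>y\<in>set ys. \<not> H (p x) (p y))}) \<le>
    fact (card V) * (2 * exp (- L))"
proof -
  define N where "N = real (card V)"
  define \<theta> where "\<theta> = s / (N - s)"
  have N: "s \<le> N / 20" "a \<le> N / 80" "N > 0" "real s > 0" "N - s > 0"
    using aN sN xs(5) by (auto simp: N_def)
  have \<theta>: "\<theta> > 0" using N by (simp add: \<theta>_def)
  interpret random_order V H a \<theta>
    by unfold_locales (use assms \<theta> in auto)
  have \<theta>N: "\<theta> * N = s + s\<^sup>2 / (N - s)"
    using N by (simp add: \<theta>_def field_simps power2_eq_square)
  have err: "s\<^sup>2 / (N - s) \<le> 20 / 19 * (s\<^sup>2 / N)"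
  proof -
    have "s\<^sup>2 / (N - s) \<le> s\<^sup>2 / (19 / 20 * N)"
      using N by (intro divide_left_mono) auto
    then show ?thesis by simp
  qed
  have e1: "s\<^sup>2 / N \<le> s / 20"
    using N by (simp add: field_simps power2_eq_square)
  have e2: "s\<^sup>2 / N \<le> s\<^sup>2 / (80 * a)"
    using N a by (intro divide_left_mono) auto
  have Ls: "L \<le> s / 16" "L \<le> s\<^sup>2 / (64 * a)" by (fact L)+
  have 1: "exp (- real s) * exp (\<theta> * N / 2) \<le> exp (- L)"
    unfolding \<theta>N using err e1 Ls N by (simp flip: exp_add)
  \<comment> \<open>Capping the exponent at 1 makes the linear bound
    \<open>exp (- y) \<le> 1 - y / 2\<close> available.\<close>
  define y where "y = min 1 (s / (4 * a))"
  have y: "0 \<le> y" "y \<le> 1" "y \<le> s / (4 * a)" using a by (auto simp: y_def)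
  have "\<gamma> \<le> 1 - y / 8"
  proof -
    have "s / (4 * a) \<le> \<theta> * (N / (4 * a))"
    proof -
      have "s \<le> \<theta> * N" unfolding \<theta>N using N by simp
      then have "s / (4 * a) \<le> \<theta> * N / (4 * a)" using a by (intro divide_right_mono) auto
      then show ?thesis by simp
    qed
    then have "exp (- \<theta> * (N / (4 * a))) \<le> exp (- y)" using y by simp
    also have "\<dots> \<le> 1 - y / 2"
    proof -
      have "exp (- y) * (1 + y) \<le> 1"
        using exp_ge_add_one_self[of y] by (simp add: exp_minus field_simps)
      moreover have "1 \<le> (1 - y / 2) * (1 + y)"
        using mult_left_mono[OF y(2,1)] by (simp add: algebra_simps)
      ultimately show ?thesis using y(1) by (smt (verit) mult_le_cancel_right_pos)
    qed
    finally show ?thesis by (simp add: \<gamma>_def N_def)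
  qed
  also have "\<dots> \<le> exp (- (y / 8))" using exp_ge_add_one_self[of "- (y / 8)"] by simp
  finally have "\<gamma> ^ s \<le> exp (- (y / 8)) ^ s" using \<gamma>_pos by (intro power_mono) auto
  also have "\<dots> = exp (- (s * y / 8))" by (simp flip: exp_of_nat_mult)
  finally have "exp (- real s) * (\<gamma> ^ s * exp (\<theta> * N)) \<le> exp (- real s) * (exp (- (s * y / 8)) * exp (\<theta> * N))"
    by (intro mult_left_mono mult_right_mono) auto
  also have "\<dots> = exp (s\<^sup>2 / (N - s) - s * y / 8)" by (simp add: \<theta>N flip: exp_add)
  also have "\<dots> \<le> exp (- L)"
  proof -
    have "s\<^sup>2 / (N - s) - s * y / 8 \<le> - L"
    \<comment> \<open>Without the cap the gain is twice \<open>s\<^sup>2 / (64 * a)\<close>, and the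
      error uses up at most \<open>16 / 19\<close> of one copy. With the cap, the gain
      \<open>s / 8\<close> minus an error of at most \<open>s / 19\<close> still exceeds
      \<open>s / 16\<close>.\<close>
    proof (cases "s / (4 * a) \<le> 1")
      case True
      then have "s * y / 8 = s\<^sup>2 / (32 * a)" using a by (simp add: y_def power2_eq_square)
      moreover have "s\<^sup>2 / (32 * a) = 2 * (s\<^sup>2 / (64 * a))" "s\<^sup>2 / (80 * a) = 64 / 80 * (s\<^sup>2 / (64 * a))"
        "0 \<le> s\<^sup>2 / (64 * a)" using a by (auto simp: field_simps)
      ultimately show ?thesis using err e2 Ls(2) by linarith
    next
      case False
      then have "s * y / 8 = s / 8" by (simp add: y_def)
      then show ?thesis using err e1 Ls(1) by linarith
    qed
    then show ?thesis by simp
  qed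
  finally have 2: "exp (- real s) * (\<gamma> ^ s * exp (\<theta> * N)) \<le> exp (- L)" .
  have "exp (- real s) * (\<gamma> ^ s * exp (\<theta> * N) + exp (\<theta> * N / 2)) \<le> 2 * exp (- L)"
    using 1 2 by (simp add: distrib_left)
  then have "fact (card V) * (exp (- real s) * (\<gamma> ^ s * exp (\<theta> * N) + exp (\<theta> * N / 2))) \<le>
      fact (card V) * (2 * exp (- L))"
    by (intro mult_left_mono) auto
  moreover have "\<theta> = s / (real (card V) - s)" by (simp add: \<theta>_def N_def)
  ultimately show ?thesis
    using card_nonadjacent_le[OF xs] unfolding N_def by linarith
qed

section \<open>Random edges between the pieces\<close>

text \<open>Double counting: by invariance the probability of \<open>X\<close> is the average over
  \<open>p\<close> of the probability that \<open>act p b\<close> lies in \<open>X\<close>, and for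
  each fixed \<open>b\<close> outside \<open>T\<close> at most an \<open>\<epsilon>\<close> fraction
  of the \<open>p\<close> contributes. This turns a count of permutations into a probability over
  the random edges.\<close>

lemma prob_le_average:
  fixes M :: "'b pmf" and act :: "'s \<Rightarrow> 'b \<Rightarrow> 'b" and \<epsilon> :: real
  assumes S: "finite S" "S \<noteq> {}"
    and inv: "\<And>p. p \<in> S \<Longrightarrow> map_pmf (act p) M = M"
    and le: "\<And>b. b \<notin> T \<Longrightarrow> card {p \<in> S. act p b \<in> X} \<le> \<epsilon> * card S"
    and eps: "\<epsilon> \<ge> 0"
  shows "measure_pmf.prob M X \<le> measure_pmf.prob M T + \<epsilon>"
proof -
  have int: "integrable (measure_pmf M) (\<lambda>b. indicator A (f b) :: real)" for A :: "'b set" and f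
    by (rule measure_pmf.integrable_const_bound[where B = 1]) auto
  have "card S * measure_pmf.prob M X = (\<Sum>p\<in>S. measure_pmf.prob (map_pmf (act p) M) X)"
    using inv by simp
  also have "\<dots> = (\<Sum>p\<in>S. measure_pmf.expectation M (\<lambda>b. indicator X (act p b)))"
  proof (rule sum.cong[OF refl])
    fix p
    have "measure_pmf.prob (map_pmf (act p) M) X = measure_pmf.expectation (map_pmf (act p) M) (indicator X)"
      by simp
    then show "measure_pmf.prob (map_pmf (act p) M) X = measure_pmf.expectation M (\<lambda>b. indicator X (act p b))"
      by (simp only: integral_map_pmf)
  qed
  also have "\<dots> = measure_pmf.expectation M (\<lambda>b. \<Sum>p\<in>S. indicator X (act p b))"
    using int by (simp add: Bochner_Integration.integral_sum)
  also have "\<dots> \<le> measure_pmf.expectation M (\<lambda>b. real (card S) * indicat_real T b + \<epsilon> * card S)"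
  proof (rule integral_mono)
    show "(\<Sum>p\<in>S. indicator X (act p b)) \<le> real (card S) * indicat_real T b + \<epsilon> * card S" for b
    proof -
      have eq: "(\<Sum>p\<in>S. indicator X (act p b) :: real) = card {p \<in> S. act p b \<in> X}"
        using S by (simp add: indicator_def sum.If_cases Int_def)
      show ?thesis
      proof (cases "b \<in> T")
        case True
        have "card {p \<in> S. act p b \<in> X} \<le> card S" using S by (intro card_mono) auto
        then show ?thesis using True eps unfolding eq by (simp add: add_increasing2)
      qed (use le[of b] eq in simp)
    qed
  qed (use int[of _ "\<lambda>b. b"] int in auto)
  also have "\<dots> = card S * (measure_pmf.prob M T + \<epsilon>)"
    using int[of T "\<lambda>b. b"] by (simp add: distrib_left mult.commute)
  finally have "card S * measure_pmf.prob M X \<le> card S * (measure_pmf.prob M T + \<epsilon>)" .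
  moreover have "real (card S) > 0" using S by (simp add: card_gt_0_iff)
  ultimately show ?thesis by (rule mult_left_le_imp_le)
qed

lemma prob_Pi_bernoulli_all_False:
  assumes "finite A" "C \<subseteq> A" "0 \<le> p" "p \<le> 1"
  shows "measure_pmf.prob (Pi_pmf A False (\<lambda>_. bernoulli_pmf p)) {b. \<forall>e\<in>C. \<not> b e} = (1 - p) ^ card C"
proof -
  have "{b. \<forall>e\<in>C. \<not> b e} = Pi A (\<lambda>e. if e \<in> C then {False} else UNIV)"
    using assms(2) by (auto simp: Pi_def)
  moreover have "measure_pmf.prob (bernoulli_pmf p) (if e \<in> C then {False} else UNIV) =
      (if e \<in> C then 1 - p else 1)" for e
    using assms by (simp add: measure_pmf_single)
  ultimately show ?thesis
    using assms by (simp add: measure_Pi_pmf_Pi prod.If_cases Int_absorb1)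
qed

lemma successively_take_drop:
  assumes "successively Q xs"
  shows "successively Q (take m (drop l xs))"
proof -
  have "successively Q (take l xs @ take m (drop l xs) @ drop m (drop l xs))"
    using assms by (simp only: append_take_drop_id)
  then show ?thesis unfolding successively_append_iff by blast
qed

lemma distinct_segments:
  assumes "distinct xs" "i < j"
  shows "distinct (take s (drop (i * s) xs) @ take s (drop (j * s) xs))"
proof -
  have "s + i * s \<le> j * s" using assms(2) by (metis Suc_leI mult_Suc mult_le_mono1)
  then have "set (take s (drop (i * s) xs)) \<subseteq> set (take (j * s) xs)"
    unfolding take_drop by (meson order_trans set_drop_subset set_take_subset_set_take)
  moreover have "set (take s (drop (j * s) xs)) \<subseteq> set (drop (j * s) xs)" by (rule set_take_subset)
  moreover have "set (take (j * s) xs) \<inter> set (drop (j * s) xs) = {}"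
    using assms(1) by (simp add: set_take_disj_set_drop_if_distinct)
  ultimately show ?thesis using assms(1) by auto
qed

text \<open>\<open>e (i, c)\<close> is vertex number \<open>c\<close> of piece \<open>i\<close>.
  Numbering the vertices inside pieces of equal size lets a permutation of the pieces act on
  vertices.\<close>

locale pieces =
  fixes V :: "'a set" and k N :: nat and e :: "nat \<times> nat \<Rightarrow> 'a"
  assumes finV: "finite V" and k: "k > 0"
    and inj: "inj_on e ({..<N} \<times> {..<k})" and img: "e ` ({..<N} \<times> {..<k}) \<subseteq> V"
begin

definition P :: "nat \<Rightarrow> 'a set" where "P i = e ` ({i} \<times> {..<k})"

lemma P_subset: "i < N \<Longrightarrow> P i \<subseteq> V"
  using img by (auto simp: P_def)

lemma P_disjoint: "i < N \<Longrightarrow> j < N \<Longrightarrow> i \<noteq> j \<Longrightarrow> P i \<inter> P j = {}"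
  using inj by (auto simp: P_def inj_on_def)

lemma card_P: "i < N \<Longrightarrow> card (P i) = k"
  unfolding P_def by (subst card_image) (auto intro: inj_on_subset[OF inj] simp: card_cartesian_product)

text \<open>Moves whole pieces and keeps the position inside the piece. Vertices outside all pieces
  stay fixed, so that a permutation of the indices gives one of \<open>V\<close>.\<close>

definition lift :: "(nat \<Rightarrow> nat) \<Rightarrow> 'a \<Rightarrow> 'a" where
  "lift p v = (if v \<in> e ` ({..<N} \<times> {..<k})
     then e (map_prod p id (inv_into ({..<N} \<times> {..<k}) e v)) else v)"

lemma lift_e: "i < N \<Longrightarrow> c < k \<Longrightarrow> lift p (e (i, c)) = e (p i, c)"
  unfolding lift_def by (subst inv_into_f_f[OF inj]) auto

lemma lift_permutes:
  assumes p: "p permutes {..<N}"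
  shows "lift p permutes V"
proof -
  let ?D = "{..<N} \<times> {..<k}"
  have lt: "p i < N" "inv p i < N" if "i < N" for i
    using permutes_in_image[OF p, of i] permutes_in_image[OF permutes_inv[OF p], of i] that by auto
  have "bij_betw (lift p) (e ` ?D) (e ` ?D)"
  proof (rule bij_betw_byWitness[where f' = "lift (inv p)"])
    show "\<forall>v\<in>e ` ?D. lift (inv p) (lift p v) = v" "\<forall>v\<in>e ` ?D. lift p (lift (inv p) v) = v"
      using lt by (auto simp: lift_e permutes_inverses[OF p])
    show "lift p ` e ` ?D \<subseteq> e ` ?D" "lift (inv p) ` e ` ?D \<subseteq> e ` ?D"
      using lt by (auto simp: lift_e)
  qed
  then have "lift p permutes e ` ?D"
    by (rule bij_imp_permutes) (simp add: lift_def)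
  then show ?thesis using img by (rule permutes_subset)
qed

lemma lift_image_P:
  assumes "i < N"
  shows "lift p ` P i = P (p i)"
  using assms by (force simp: P_def lift_e image_iff)

text \<open>Adjacency of pieces through random edges, with \<open>b\<close> their indicator
  function.\<close>

definition touch :: "('a set \<Rightarrow> bool) \<Rightarrow> nat \<Rightarrow> nat \<Rightarrow> bool" where
  "touch b i j \<longleftrightarrow> (\<exists>x\<in>P i. \<exists>y\<in>P j. x \<noteq> y \<and> b {x, y})"

lemma symp_touch: "symp (touch b)"
  unfolding touch_def by (intro sympI) (metis insert_commute)

lemma touch_lift:
  assumes p: "p permutes {..<N}" and "i < N" "j < N"
  shows "touch (b \<circ> image (lift p)) i j \<longleftrightarrow> touch b (p i) (p j)"
proof -
  have "lift p x \<noteq> lift p y \<longleftrightarrow> x \<noteq> y" for x y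
    using permutes_inj[OF lift_permutes[OF p]] by (auto dest: injD)
  then show ?thesis
    unfolding touch_def lift_image_P[OF assms(2), symmetric] lift_image_P[OF assms(3), symmetric]
    by simp
qed

definition edge_law :: "real \<Rightarrow> ('a set \<Rightarrow> bool) pmf" where
  "edge_law q = Pi_pmf ([V]\<^bsup>2\<^esup>) False (\<lambda>_. bernoulli_pmf q)"

lemma finite_pairs: "finite ([V]\<^bsup>2\<^esup>)"
  using finV by (rule finite_imp_finite_nsets)

text \<open>The pairs are independent and equally likely, so relabelling them by a permutation of
  \<open>V\<close> leaves the product law unchanged.\<close>

lemma edge_law_lift:
  assumes p: "p permutes {..<N}"
  shows "map_pmf (\<lambda>b. b \<circ> image (lift p)) (edge_law q) = edge_law q"
proof -
  have lp: "lift p permutes V" using p by (rule lift_permutes)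
  \<comment> \<open>Sets that are not pairs of \<open>V\<close> carry the default value
    \<open>False\<close>; \<open>lift p\<close> must not move them onto pairs.\<close>
  have mem: "lift p ` A \<in> [V]\<^bsup>2\<^esup> \<longleftrightarrow> A \<in> [V]\<^bsup>2\<^esup>" for A
  proof -
    have "lift p ` A \<subseteq> V \<longleftrightarrow> A \<subseteq> V" using permutes_in_image[OF lp] by auto
    moreover have "card (lift p ` A) = card A" "finite (lift p ` A) \<longleftrightarrow> finite A"
      using permutes_inj_on[OF lp, of A] by (simp_all add: card_image finite_image_iff)
    ultimately show ?thesis by (simp add: nsets_def)
  qed
  have "bij_betw (image (lift p)) ([V]\<^bsup>2\<^esup>) ([V]\<^bsup>2\<^esup>)"
    using permutes_imp_bij[OF lp] by (rule bij_betw_nsets)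
  then show ?thesis
    unfolding edge_law_def using finite_pairs mem by (subst (2) Pi_pmf_bij_betw) auto
qed

definition piece_path :: "('a set \<Rightarrow> bool) \<Rightarrow> nat list \<Rightarrow> bool" where
  "piece_path b xs \<longleftrightarrow> distinct xs \<and> set xs \<subseteq> {..<N} \<and> successively (touch b) xs"

text \<open>Union bound over two disjoint families of \<open>m\<close> pieces: there are at most
  \<open>4 ^ N\<close> choices, and each has \<open>(m * k)\<^sup>2\<close> vertex pairs between its
  families that must all be absent. If no choice fails in this way, \<open>long_path\<close> yields
  a path on at least \<open>N - 2 * (m - 1)\<close> pieces, and a prefix of it has length
  \<open>l\<close>.\<close>

lemma prob_no_path_le:
  assumes q: "0 \<le> q" "q \<le> 1" and m: "m > 0" and l: "l + 2 * (m - 1) \<le> N"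
  shows "measure_pmf.prob (edge_law q) {b. \<nexists>xs. piece_path b xs \<and> length xs = l} \<le>
    4 ^ N * (1 - q) ^ ((m * k)\<^sup>2)"
proof -
  define \<A> where "\<A> = {(A, B). A \<subseteq> {..<N} \<and> B \<subseteq> {..<N} \<and> A \<inter> B = {} \<and> card A = m \<and> card B = m}"
  define cross where "cross A B = (\<lambda>(x, y). {x, y}) ` ((\<Union>i\<in>A. P i) \<times> (\<Union>j\<in>B. P j))" for A B
  have sub\<A>: "\<A> \<subseteq> Pow {..<N} \<times> Pow {..<N}" by (auto simp: \<A>_def)
  then have fin\<A>: "finite \<A>" by (rule finite_subset) simp
  have "card \<A> \<le> card (Pow {..<N} \<times> Pow {..<N})" using sub\<A> by (intro card_mono) auto
  also have "\<dots> = 2 ^ N * 2 ^ N" by (simp add: card_cartesian_product card_Pow)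
  also have "\<dots> = 4 ^ N" by (simp flip: power_mult_distrib)
  finally have card\<A>: "real (card \<A>) \<le> 4 ^ N" by (metis of_nat_le_iff of_nat_numeral of_nat_power)
  have each: "measure_pmf.prob (edge_law q) {b. \<forall>f\<in>cross A B. \<not> b f} = (1 - q) ^ ((m * k)\<^sup>2)"
    if "(A, B) \<in> \<A>" for A B
  proof -
    have AB: "A \<subseteq> {..<N}" "B \<subseteq> {..<N}" "A \<inter> B = {}" "card A = m" "card B = m"
      using that by (auto simp: \<A>_def)
    let ?X = "\<Union>i\<in>A. P i" and ?Y = "\<Union>j\<in>B. P j"
    have cU: "card (\<Union>i\<in>Z. P i) = card Z * k" if "Z \<subseteq> {..<N}" for Z
    proof -
      have "card (\<Union>i\<in>Z. P i) = (\<Sum>i\<in>Z. card (P i))"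
        using that finite_subset[OF that] P_disjoint
        by (intro card_UN_disjoint) (auto simp: P_def subset_iff)
      also have "\<dots> = (\<Sum>i\<in>Z. k)" using that card_P by (intro sum.cong) auto
      finally show ?thesis by simp
    qed
    have "P i \<inter> P j = {}" if "i \<in> A" "j \<in> B" for i j
      by (rule P_disjoint) (use AB(1-3) that in auto)
    then have dj: "?X \<inter> ?Y = {}" by blast
    have XV: "?X \<subseteq> V" "?Y \<subseteq> V" using AB P_subset by blast+
    have "inj_on (\<lambda>(x, y). {x, y}) (?X \<times> ?Y)"
      using dj by (auto simp: inj_on_def doubleton_eq_iff)
    then have "card (cross A B) = (m * k)\<^sup>2"
      unfolding cross_def by (simp add: card_image card_cartesian_product cU AB power2_eq_square)
    moreover have "cross A B \<subseteq> [V]\<^bsup>2\<^esup>"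
    proof
      fix f assume "f \<in> cross A B"
      then obtain x y where "f = {x, y}" "x \<in> ?X" "y \<in> ?Y" by (auto simp: cross_def)
      moreover then have "x \<noteq> y" using dj by blast
      ultimately show "f \<in> [V]\<^bsup>2\<^esup>" using XV by (simp add: subset_iff)
    qed
    ultimately show ?thesis
      unfolding edge_law_def using prob_Pi_bernoulli_all_False[OF finite_pairs _ q] by simp
  qed
  have "{b. \<nexists>xs. piece_path b xs \<and> length xs = l} \<subseteq> (\<Union>(A, B)\<in>\<A>. {b. \<forall>f\<in>cross A B. \<not> b f})"
  proof
    fix b assume b: "b \<in> {b. \<nexists>xs. piece_path b xs \<and> length xs = l}"
    have "\<exists>A B. (A, B) \<in> \<A> \<and> (\<forall>i\<in>A. \<forall>j\<in>B. \<not> touch b i j)"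
    proof (rule ccontr)
      assume none: "\<not> ?thesis"
      obtain xs where xs: "distinct xs" "set xs \<subseteq> {..<N}" "successively (touch b) xs"
        "card {..<N} \<le> length xs + 2 * (m - 1)"
        using long_path[of "{..<N}" "touch b" m] symp_touch m none unfolding \<A>_def by auto
      have "piece_path b (take l xs)"
        using xs successively_take_drop[OF xs(3), of l 0] set_take_subset[of l xs]
        by (auto simp: piece_path_def)
      moreover have "length (take l xs) = l" using xs(4) l by simp
      ultimately show False using b by blast
    qed
    then obtain A B where AB: "(A, B) \<in> \<A>" "\<forall>i\<in>A. \<forall>j\<in>B. \<not> touch b i j" by blast
    have "\<not> b f" if fc: "f \<in> cross A B" for f
    proof -
      obtain i j x y where f: "f = {x, y}" "i \<in> A" "j \<in> B" "x \<in> P i" "y \<in> P j"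
        using fc by (auto simp: cross_def)
      then have "x \<noteq> y" using P_disjoint[of i j] AB(1) by (auto simp: \<A>_def)
      then show ?thesis using AB(2) f by (auto simp: touch_def)
    qed
    then show "b \<in> (\<Union>(A, B)\<in>\<A>. {b. \<forall>f\<in>cross A B. \<not> b f})" using AB(1) by blast
  qed
  then have "measure_pmf.prob (edge_law q) {b. \<nexists>xs. piece_path b xs \<and> length xs = l} \<le>
     measure_pmf.prob (edge_law q) (\<Union>(A, B)\<in>\<A>. {b. \<forall>f\<in>cross A B. \<not> b f})"
    by (intro measure_pmf.finite_measure_mono) auto
  also have "\<dots> \<le> (\<Sum>AB\<in>\<A>. measure_pmf.prob (edge_law q) (case AB of (A, B) \<Rightarrow> {b. \<forall>f\<in>cross A B. \<not> b f}))"
    using fin\<A> by (intro measure_pmf.finite_measure_subadditive_finite) auto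
  also have "\<dots> = (\<Sum>AB\<in>\<A>. (1 - q) ^ ((m * k)\<^sup>2))"
    using each by (intro sum.cong) auto
  also have "\<dots> \<le> 4 ^ N * (1 - q) ^ ((m * k)\<^sup>2)"
    using card\<A> q by (simp add: mult_right_mono)
  finally show ?thesis .
qed

abbreviation segment :: "nat \<Rightarrow> nat list \<Rightarrow> nat \<Rightarrow> nat list" where
  "segment s xs j \<equiv> take s (drop (j * s) xs)"

text \<open>\<open>H\<close> stands for adjacency of pieces in \<open>G\<close>, which does not vary
  with \<open>b\<close>: the random edges supply the path, and \<open>H\<close> the adjacency of its
  segments.\<close>

definition good :: "(nat \<Rightarrow> nat \<Rightarrow> bool) \<Rightarrow> nat \<Rightarrow> nat \<Rightarrow> ('a set \<Rightarrow> bool) \<Rightarrow> bool" where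
  "good H s r b \<longleftrightarrow> (\<exists>xs. piece_path b xs \<and> length xs = r * s \<and>
     (\<forall>j<r. \<forall>i<j. \<exists>x\<in>set (segment s xs i). \<exists>y\<in>set (segment s xs j). H x y))"

lemma length_segment:
  assumes "length xs = r * s" "j < r"
  shows "length (segment s xs j) = s"
proof -
  have "j * s + s \<le> r * s" using assms(2) by (metis Suc_leI add.commute mult_Suc mult_le_mono1)
  then show ?thesis using assms(1) by simp
qed

text \<open>For a fixed \<open>b\<close> with a path \<open>xs\<close>, a random permutation of the
  pieces turns it into \<open>map p xs\<close>, so its segments sit at uniformly random places. A
  union bound over at most \<open>r\<^sup>2\<close> pairs of segments gives the second summand; the
  first one accounts for the absence of a path.\<close>

lemma prob_not_good_le:
  fixes a L :: real
  assumes q: "0 \<le> q" "q \<le> 1" and m: "m > 0" and l: "r * s + 2 * (m - 1) \<le> N"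
    and sym: "symp H" and a: "a > 0"
    and ind: "\<And>I. I \<subseteq> {..<N} \<Longrightarrow> (\<forall>x\<in>I. \<forall>y\<in>I. x \<noteq> y \<longrightarrow> \<not> H x y) \<Longrightarrow> real (card I) \<le> a"
    and s: "s > 0" and aN: "a \<le> N / 80" and sN: "s \<le> N / 20"
    and L: "L \<le> s / 16" "L \<le> s\<^sup>2 / (64 * a)"
  shows "measure_pmf.prob (edge_law q) {b. \<not> good H s r b} \<le>
    4 ^ N * (1 - q) ^ ((m * k)\<^sup>2) + r\<^sup>2 * (2 * exp (- L))"
proof -
  let ?S = "{p. p permutes {..<N}}"
  have "measure_pmf.prob (edge_law q) {b. \<not> good H s r b} \<le>
    measure_pmf.prob (edge_law q) {b. \<nexists>xs. piece_path b xs \<and> length xs = r * s} + r\<^sup>2 * (2 * exp (- L))"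
  \<comment> \<open>The inverse appears because \<open>b\<close> is composed on the right: a path
    \<open>xs\<close> for \<open>b\<close> becomes the path \<open>map p xs\<close> for
    \<open>b \<circ> image (lift (inv p))\<close>.\<close>
  proof (rule prob_le_average[where S = ?S and act = "\<lambda>p b. b \<circ> image (lift (inv p))"])
    show "finite ?S" by (simp add: finite_permutations)
    show "?S \<noteq> {}" using permutes_id by blast
    show "map_pmf (\<lambda>b. b \<circ> image (lift (inv p))) (edge_law q) = edge_law q" if "p \<in> ?S" for p
      using that by (intro edge_law_lift) (simp add: permutes_inv)
    show "real (card {p \<in> ?S. b \<circ> image (lift (inv p)) \<in> {b. \<not> good H s r b}}) \<le> r\<^sup>2 * (2 * exp (- L)) * card ?S"
      if "b \<notin> {b. \<nexists>xs. piece_path b xs \<and> length xs = r * s}" for b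
    proof -
      from that obtain xs where xs: "piece_path b xs" "length xs = r * s" by auto
      then have xs': "distinct xs" "set xs \<subseteq> {..<N}" "successively (touch b) xs"
        by (auto simp: piece_path_def)
      define J where "J = {(i, j). i < j \<and> j < r}"
      define D where "D = (\<lambda>(i, j). {p. p permutes {..<N} \<and>
        (\<forall>x\<in>set (segment s xs i). \<forall>y\<in>set (segment s xs j). \<not> H (p x) (p y))})"
      have "{p \<in> ?S. b \<circ> image (lift (inv p)) \<in> {b. \<not> good H s r b}} \<subseteq> (\<Union>ij\<in>J. D ij)"
      proof
        fix p assume "p \<in> {p \<in> ?S. b \<circ> image (lift (inv p)) \<in> {b. \<not> good H s r b}}"
        then have p: "p permutes {..<N}" and bad: "\<not> good H s r (b \<circ> image (lift (inv p)))" by auto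
        have pN: "p i < N" if "i < N" for i using permutes_in_image[OF p, of i] that by simp
        have "piece_path (b \<circ> image (lift (inv p))) (map p xs)"
          unfolding piece_path_def
        proof (intro conjI)
          show "distinct (map p xs)"
            using xs'(1) permutes_inj_on[OF p] by (simp add: distinct_map)
          show "set (map p xs) \<subseteq> {..<N}" using xs'(2) pN by auto
          show "successively (touch (b \<circ> image (lift (inv p)))) (map p xs)"
            unfolding successively_map
          proof (rule successively_mono[OF xs'(3)])
            fix i j assume "i \<in> set xs" "j \<in> set xs" "touch b i j"
            then show "touch (b \<circ> image (lift (inv p))) (p i) (p j)"
              using touch_lift[OF permutes_inv[OF p], of "p i" "p j" b] pN xs'(2)
              by (auto simp: permutes_inverses[OF p])
          qed
        qed
        moreover have "length (map p xs) = r * s" using xs(2) by simp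
        ultimately have "\<not> (\<forall>j<r. \<forall>i<j. \<exists>x\<in>set (segment s (map p xs) i). \<exists>y\<in>set (segment s (map p xs) j). H x y)"
          using bad unfolding good_def by blast
        then obtain i j where ij: "i < j" "j < r"
          "\<forall>x\<in>set (segment s (map p xs) i). \<forall>y\<in>set (segment s (map p xs) j). \<not> H x y"
          by blast
        then have "p \<in> D (i, j)"
          using p by (simp add: D_def take_map drop_map)
        then show "p \<in> (\<Union>ij\<in>J. D ij)" using ij by (auto simp: J_def)
      qed
      moreover have J: "finite J" "card J \<le> r\<^sup>2"
      proof -
        have sub: "J \<subseteq> {..<r} \<times> {..<r}" by (auto simp: J_def)
        then show "finite J" by (rule finite_subset) simp
        show "card J \<le> r\<^sup>2"
          using card_mono[OF _ sub] by (simp add: card_cartesian_product power2_eq_square)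
      qed
      moreover have "finite (D ij)" for ij
        by (rule finite_subset[of _ ?S]) (auto simp: D_def finite_permutations split: prod.splits)
      ultimately have "card {p \<in> ?S. b \<circ> image (lift (inv p)) \<in> {b. \<not> good H s r b}} \<le> card (\<Union>ij\<in>J. D ij)"
        by (intro card_mono) auto
      also have "\<dots> \<le> (\<Sum>ij\<in>J. card (D ij))" using J(1) by (rule card_UN_le)
      finally have "real (card {p \<in> ?S. b \<circ> image (lift (inv p)) \<in> {b. \<not> good H s r b}}) \<le> real (\<Sum>ij\<in>J. card (D ij))"
        by (simp only: of_nat_le_iff)
      also have "\<dots> \<le> (\<Sum>ij\<in>J. fact N * (2 * exp (- L)))"
        unfolding of_nat_sum
      proof (rule sum_mono)
        fix ij assume "ij \<in> J"
        then obtain i j where ij: "ij = (i, j)" "i < j" "j < r" by (auto simp: J_def)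
        have sub: "set (segment s xs j) \<subseteq> {..<N}" for j
          using xs'(2) set_take_subset set_drop_subset by fast
        show "real (card (D ij)) \<le> fact N * (2 * exp (- L))"
          using card_nonadjacent_permutations_le[OF finite_lessThan sym a ind
              distinct_segments[OF xs'(1) ij(2)] _ length_segment[OF xs(2)] length_segment[OF xs(2) ij(3)] s _ _ L(1)]
            sub ij aN sN L(2) by (simp add: D_def)
      qed
      also have "\<dots> = card J * (fact N * (2 * exp (- L)))" by simp
      also have "\<dots> \<le> r\<^sup>2 * (fact N * (2 * exp (- L)))"
        using J(2) by (intro mult_right_mono) (auto simp flip: of_nat_power)
      finally show ?thesis by (simp add: card_permutations mult_ac)
    qed
  qed simp
  also have "\<dots> \<le> 4 ^ N * (1 - q) ^ ((m * k)\<^sup>2) + r\<^sup>2 * (2 * exp (- L))"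
    using prob_no_path_le[OF q m l] by simp
  finally show ?thesis by simp
qed

end

section \<open>The Hadwiger number\<close>

text \<open>The branch sets are the unions of the pieces along one segment: edges of
  \<open>G\<close> link each piece, random edges link consecutive pieces, and edges of
  \<open>G\<close> join different segments.\<close>

lemma (in pieces) good_imp_hadwiger:
  assumes G: "simple_graph G" "verts G = V"
    and linked: "\<And>i. i < N \<Longrightarrow> linked (\<lambda>x y. {x, y} \<in> edges G) (P i)"
    and s: "s > 0" and good: "good (\<lambda>i j. \<exists>x\<in>P i. \<exists>y\<in>P j. {x, y} \<in> edges G) s r b"
  shows "r \<le> hadwiger_number (graph_union G (V, {f \<in> [V]\<^bsup>2\<^esup>. b f}))"
proof -
  define K where "K = graph_union G (V, {f \<in> [V]\<^bsup>2\<^esup>. b f})"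
  have VK: "verts K = V" and EK: "edges K = edges G \<union> {f \<in> [V]\<^bsup>2\<^esup>. b f}"
    using G by (simp_all add: K_def graph_union_def)
  have K: "simple_graph K" using G finV by (auto simp: simple_graph_def VK EK)
  from good obtain xs where xs: "distinct xs" "set xs \<subseteq> {..<N}" "successively (touch b) xs"
    "length xs = r * s"
    and adj: "\<And>i j. i < j \<Longrightarrow> j < r \<Longrightarrow>
      \<exists>x\<in>set (segment s xs i). \<exists>y\<in>set (segment s xs j). \<exists>x\<in>P x. \<exists>y\<in>P y. {x, y} \<in> edges G"
    unfolding good_def piece_path_def by blast
  have seg: "set (segment s xs j) \<subseteq> {..<N}" for j
    using xs(2) set_take_subset set_drop_subset by fast
  define B where "B j = (\<Union>i\<in>set (segment s xs j). P i)" for j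
  have "is_minor (complete_graph r) K"
  proof (rule is_minor_complete_graphI[OF K])
    have disj: "B i \<inter> B j = {}" if "i < j" for i j
    proof -
      have "P x \<inter> P y = {}" if "x \<in> set (segment s xs i)" "y \<in> set (segment s xs j)" for x y
        by (rule P_disjoint) (use that seg distinct_segments[OF xs(1) \<open>i < j\<close>, of s] in auto)
      then show ?thesis unfolding B_def by blast
    qed
    show "disjoint_family_on B {..<r}"
      unfolding disjoint_family_on_def using disj by (metis inf_commute nat_neq_iff)
    show "B j \<noteq> {} \<and> B j \<subseteq> verts K \<and> linked (\<lambda>x y. {x, y} \<in> edges K) (B j)" if j: "j < r" for j
    proof (intro conjI)
      have "segment s xs j \<noteq> []" using length_segment[OF xs(4) j] s by auto
      then show "B j \<noteq> {}" using k by (auto simp: B_def P_def lessThan_empty_iff)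
      show "B j \<subseteq> verts K" unfolding B_def VK using P_subset seg by blast
      show "linked (\<lambda>x y. {x, y} \<in> edges K) (B j)"
        unfolding B_def
      proof (rule linked_Union_path)
        show "successively (\<lambda>i j. \<exists>x\<in>P i. \<exists>y\<in>P j. {x, y} \<in> edges K) (segment s xs j)"
        proof (rule successively_mono[OF successively_take_drop[OF xs(3)]])
          fix i l assume il: "i \<in> set (segment s xs j)" "l \<in> set (segment s xs j)" "touch b i l"
          then obtain x y where "x \<in> P i" "y \<in> P l" "x \<noteq> y" "b {x, y}"
            by (auto simp: touch_def)
          moreover have "P i \<subseteq> V" "P l \<subseteq> V" using il seg P_subset by blast+
          ultimately show "\<exists>x\<in>P i. \<exists>y\<in>P l. {x, y} \<in> edges K"
            unfolding EK by (intro bexI[of _ x] bexI[of _ y]) auto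
        qed
        show "linked (\<lambda>x y. {x, y} \<in> edges K) (P i)" if "i \<in> set (segment s xs j)" for i
          by (rule linked_mono[OF linked]) (use that seg[of j] EK in auto)
        show "symp (\<lambda>x y. {x, y} \<in> edges K)" by (auto intro: sympI simp: insert_commute)
      qed
    qed
    show "\<exists>x\<in>B i. \<exists>y\<in>B j. {x, y} \<in> edges K" if "i < j" "j < r" for i j
      using adj[OF that] unfolding B_def EK by blast
  qed
  then show ?thesis
    unfolding hadwiger_number_def K_def[symmetric]
    using hadwiger_set_finite_nonempty(1)[OF K] by (intro Max_ge) auto
qed

lemma card_le_independence_number:
  assumes "simple_graph G" "I \<subseteq> verts G" "\<forall>x\<in>I. \<forall>y\<in>I. x \<noteq> y \<longrightarrow> {x, y} \<notin> edges G"
  shows "card I \<le> independence_number G"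
  unfolding independence_number_def
  using assms independence_set_finite_nonempty(1)[OF assms(1)]
  by (intro Max_ge) (auto simp: indep_def)

text \<open>Numbers the pieces from \<open>linked_pieces\<close> and the vertices of each. The
  independent set found there is bounded by the independence number, which limits the uncovered
  vertices.\<close>

lemma ex_pieces:
  assumes G: "simple_graph G" and k: "k > 0"
  shows "\<exists>N e. pieces (verts G) k N e \<and>
    (\<forall>i<N. linked (\<lambda>x y. {x, y} \<in> edges G) (pieces.P k e i)) \<and>
    card (verts G) \<le> k * N + (k - 1) * independence_number G"
proof -
  let ?E = "\<lambda>x y. {x, y} \<in> edges G"
  have fin: "finite (verts G)" using G by (simp add: simple_graph_def)
  have "symp ?E" by (auto intro: sympI simp: insert_commute)
  from linked_pieces[OF fin this k] obtain \<P> I where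
    \<P>: "finite \<P>" "disjoint \<P>" "\<And>X. X \<in> \<P> \<Longrightarrow> X \<subseteq> verts G \<and> card X = k \<and> linked ?E X"
    and I: "I \<subseteq> verts G" "\<forall>x\<in>I. \<forall>y\<in>I. x \<noteq> y \<longrightarrow> \<not> ?E x y"
    and c: "card (verts G) \<le> k * card \<P> + (k - 1) * card I"
    by (elim exE conjE) (rule that; blast)
  obtain \<phi> where \<phi>: "bij_betw \<phi> {..<card \<P>} \<P>"
    using ex_bij_betw_nat_finite[OF \<P>(1)] by (auto simp: lessThan_atLeast0)
  have "\<exists>g. bij_betw g {..<k} X" if "X \<in> \<P>" for X
  proof -
    have "finite X" "card X = k" using \<P>(3)[OF that] k by (auto intro: card_ge_0_finite)
    then show ?thesis using ex_bij_betw_nat_finite[of X] by (auto simp: lessThan_atLeast0)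
  qed
  then obtain \<psi> where \<psi>: "\<And>X. X \<in> \<P> \<Longrightarrow> bij_betw (\<psi> X) {..<k} X" by metis
  define e where "e = (\<lambda>(i, c). \<psi> (\<phi> i) c)"
  have \<phi>P: "\<phi> i \<in> \<P>" if "i < card \<P>" for i using \<phi> that by (auto simp: bij_betw_def)
  have e_mem: "e (i, c) \<in> \<phi> i" if "i < card \<P>" "c < k" for i c
    using \<psi>[OF \<phi>P[OF that(1)]] that(2) by (auto simp: e_def bij_betw_def)
  have pc: "pieces (verts G) k (card \<P>) e"
  proof
    show "inj_on e ({..<card \<P>} \<times> {..<k})"
    proof (rule inj_onI)
      fix u v assume uv: "u \<in> {..<card \<P>} \<times> {..<k}" "v \<in> {..<card \<P>} \<times> {..<k}" "e u = e v"
      then obtain i c j d where uv': "u = (i, c)" "v = (j, d)"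
        and ij: "i \<in> {..<card \<P>}" "c \<in> {..<k}" "j \<in> {..<card \<P>}" "d \<in> {..<k}"
        by auto
      have eq: "e (i, c) = e (j, d)" using uv(3) uv' by simp
      have "\<phi> i \<inter> \<phi> j \<noteq> {}" using e_mem[of i c] e_mem[of j d] ij eq by auto
      then have "\<phi> i = \<phi> j"
        using \<P>(2) \<phi>P[of i] \<phi>P[of j] ij unfolding disjoint_def by blast
      then have "i = j" using \<phi> ij by (auto simp: bij_betw_def dest: inj_onD)
      moreover have "c = d" using \<open>i = j\<close> eq \<psi>[OF \<phi>P[of i]] ij
        by (auto simp: e_def bij_betw_def dest: inj_onD)
      ultimately show "u = v" using uv' by simp
    qed
    show "e ` ({..<card \<P>} \<times> {..<k}) \<subseteq> verts G"
      using e_mem \<phi>P \<P>(3) by blast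
  qed (use fin k in auto)
  have "linked ?E (pieces.P k e i)" if "i < card \<P>" for i
  proof -
    have "pieces.P k e i = \<phi> i"
      unfolding pieces.P_def[OF pc] using \<psi>[OF \<phi>P[OF that]]
      by (force simp: e_def bij_betw_def image_iff)
    then show ?thesis using \<P>(3)[OF \<phi>P[OF that]] by simp
  qed
  moreover have "card (verts G) \<le> k * card \<P> + (k - 1) * independence_number G"
    using c card_le_independence_number[OF G I(1)] I(2) by (meson add_left_mono le_trans mult_le_mono2)
  ultimately show ?thesis using pc by blast
qed

section \<open>Explicit constants and the choice of number and length of segments\<close>

lemma ln_4_less: "ln (4 :: real) \<le> 25 / 18"
proof -
  have "ln (4 :: real) = ln (2 ^ 2)" by simp
  also have "\<dots> = 2 * ln 2" by (subst ln_realpow) auto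
  finally show ?thesis using ln2_le_25_over_36 by simp
qed

text \<open>With \<open>x = n / k\<close> and edge probability \<open>8 / (n * k)\<close>, the
  exponent \<open>q * (m * k)\<^sup>2\<close> equals \<open>8 * m\<^sup>2 / x\<close> and is at
  least \<open>1.6 * N\<close>, while \<open>ln 4\<close> is below \<open>1.39\<close>. The
  difference exceeds \<open>x / 10\<close>.\<close>

lemma four_power_times_le:
  fixes q x :: real and k m N :: nat
  assumes q: "0 \<le> q" "q \<le> 1" "q * (real k)\<^sup>2 * x = 8" and x: "x > 0" "99 / 100 * x \<le> N"
    and m: "9 / 20 * N \<le> m"
  shows "4 ^ N * (1 - q) ^ ((m * k)\<^sup>2) \<le> exp (- (x / 10))"
proof -
  have "(1 - q) ^ ((m * k)\<^sup>2) \<le> exp (- q) ^ ((m * k)\<^sup>2)"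
    using q exp_ge_add_one_self[of "- q"] by (intro power_mono) auto
  also have "\<dots> = exp (- (q * (m * k)\<^sup>2))" by (simp add: mult.commute flip: exp_of_nat_mult)
  finally have 1: "(1 - q) ^ ((m * k)\<^sup>2) \<le> exp (- (q * (m * k)\<^sup>2))" .
  have "(4 :: real) ^ N = exp (N * ln 4)" by (simp add: exp_of_nat_mult)
  with 1 have "4 ^ N * (1 - q) ^ ((m * k)\<^sup>2) \<le> exp (N * ln 4) * exp (- (q * (m * k)\<^sup>2))"
    by (simp add: mult_left_mono)
  also have "\<dots> = exp (N * ln 4 - q * (m * k)\<^sup>2)" by (simp flip: exp_add)
  also have "\<dots> \<le> exp (- (x / 10))"
  proof -
    have "(9 / 20 * real N)\<^sup>2 \<le> (real m)\<^sup>2" using m by (intro power_mono) auto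
    moreover have "99 / 100 * x * real N \<le> real N * real N" using x by (intro mult_right_mono) auto
    ultimately have "81 / 400 * (99 / 100 * N) * x \<le> (real m)\<^sup>2"
      by (simp add: power2_eq_square algebra_simps)
    moreover have "q * (m * k)\<^sup>2 * x = (q * (real k)\<^sup>2 * x) * (real m)\<^sup>2"
      by (simp add: power_mult_distrib)
    ultimately have "8 * (81 / 400 * (99 / 100 * N)) * x \<le> q * (m * k)\<^sup>2 * x"
      unfolding q(3) by linarith
    then have "8 * (81 / 400 * (99 / 100 * N)) \<le> q * (m * k)\<^sup>2"
      using x(1) by (rule mult_right_le_imp_le)
    moreover have "N * ln 4 \<le> N * (25 / 18)" using ln_4_less by (intro mult_left_mono) auto
    ultimately have "N * ln 4 - q * (m * k)\<^sup>2 \<le> - (x / 10)" using x by linarith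
    then show ?thesis by simp
  qed
  finally show ?thesis .
qed

text \<open>Here \<open>n / k\<close> takes the place of the number \<open>N\<close> of pieces: the
  bound on the independence number leaves at most \<open>n / 100\<close> vertices uncovered, so
  \<open>N \<ge> 99 / 100 * (n / k)\<close>. The constants in the bounds on \<open>s\<close> and
  \<open>r * s\<close> absorb this loss.\<close>

lemma prob_hadwiger_ge:
  fixes G :: "'a graph" and k r s :: nat and L q :: real
  defines "n \<equiv> card (verts G)"
  assumes G: "simple_graph G" and k: "k > 0" and n: "n \<ge> 8"
    and ind: "independence_number G \<le> n / (100 * real k)"
    and s: "s > 0" "s \<le> n / (25 * real k)" and r: "r * s \<le> 9 / 100 * (n / k)"
    and L: "L \<le> s / 16" "L \<le> (real s)\<^sup>2 / (64 * independence_number G)"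
  shows "measure_pmf.prob (binomial_random_graph (verts G) (8 / (real n * real k)))
      {R. r \<le> hadwiger_number (graph_union G R)} \<ge>
    1 - (exp (- (n / k / 10)) + (real r)\<^sup>2 * (2 * exp (- L)))"
proof -
  define V where "V = verts G"
  define a where "a = real (independence_number G)"
  define q where "q = 8 / (real n * real k)"
  define x where "x = real n / real k"
  obtain N e where pc: "pieces V k N e"
    and linked: "\<And>i. i < N \<Longrightarrow> linked (\<lambda>x y. {x, y} \<in> edges G) (pieces.P k e i)"
    and cov: "n \<le> k * N + (k - 1) * independence_number G"
    using ex_pieces[OF G k] unfolding V_def n_def by blast
  interpret pieces V k N e by (rule pc)
  have x: "x > 0" "n = x * k" using n k by (auto simp: x_def)
  have q: "0 \<le> q" "q \<le> 1"
  proof -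
    \<comment> \<open>This keeps \<open>q\<close> at most 1, so that \<open>bernoulli_pmf\<close>
      does not truncate it.\<close>
    have "8 \<le> real n * real k" using n k mult_mono[of 8 "real n" 1 "real k"] by simp
    then show "0 \<le> q" "q \<le> 1" by (auto simp: q_def)
  qed
  have ax: "a \<le> x / 100" using ind by (simp add: a_def x_def)
  have Nx: "99 / 100 * x \<le> N"
  proof -
    have "real n \<le> real (k * N + (k - 1) * independence_number G)"
      using cov by (simp only: of_nat_le_iff)
    also have "\<dots> \<le> k * N + k * a"
      by (simp add: a_def mult_right_mono)
    also have "\<dots> \<le> k * N + k * (x / 100)" using ax by (intro add_left_mono mult_left_mono) auto
    finally have "k * (99 / 100 * x) \<le> real k * real N" using x(2) by (simp add: algebra_simps)
    then show ?thesis using k by (simp only: mult_le_cancel_left_pos of_nat_0_less_iff)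
  qed
  have apos: "a > 0"
  proof -
    obtain v where "v \<in> verts G" using n by (metis all_not_in_conv card.empty n_def not_numeral_le_zero)
    then show ?thesis using card_le_independence_number[OF G, of "{v}"] by (simp add: a_def)
  qed
  \<comment> \<open>\<open>9 * N / 20\<close> rounded up: then
    \<open>2 * (m - 1) \<le> 9 * N / 10\<close>, which leaves room for a path on
    \<open>N / 10\<close> pieces.\<close>
  define m where "m = (9 * N + 19) div 20"
  have Npos: "N > 0" using Nx x(1) by (cases N) auto
  have m: "m > 0" "9 * N \<le> 20 * m" "20 * (m - 1) \<le> 9 * N" using Npos unfolding m_def by linarith+
  have rsN: "r * s + 2 * (m - 1) \<le> N"
  proof -
    have "real (r * s) \<le> N / 10" using r Nx by (simp add: x_def)
    then have "10 * (r * s) \<le> N" by linarith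
    then show ?thesis using m(3) by linarith
  qed
  let ?H = "\<lambda>i j. \<exists>x\<in>P i. \<exists>y\<in>P j. {x, y} \<in> edges G"
  \<comment> \<open>One representative vertex per piece turns an independent set of pieces into an
    independent set of \<open>G\<close>.\<close>
  have indH: "real (card I) \<le> a" if I: "I \<subseteq> {..<N}" "\<forall>i\<in>I. \<forall>j\<in>I. i \<noteq> j \<longrightarrow> \<not> ?H i j" for I
  proof -
    define f where "f i = e (i, 0)" for i :: nat
    have f: "f i \<in> P i" for i using k by (auto simp: f_def P_def)
    have "inj_on f I" using inj I(1) k by (auto simp: f_def inj_on_def)
    then have "card I = card (f ` I)" by (simp add: card_image)
    also have "\<dots> \<le> independence_number G"
    proof (rule card_le_independence_number[OF G])
      show "f ` I \<subseteq> verts G" using f I(1) P_subset unfolding V_def by blast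
      show "\<forall>x\<in>f ` I. \<forall>y\<in>f ` I. x \<noteq> y \<longrightarrow> {x, y} \<notin> edges G"
      proof (intro ballI impI)
        fix x y assume "x \<in> f ` I" "y \<in> f ` I" "x \<noteq> y"
        then obtain i j where ij: "x = f i" "y = f j" "i \<in> I" "j \<in> I" "i \<noteq> j" by auto
        with I(2) have "\<not> ?H i j" by blast
        then show "{x, y} \<notin> edges G" using f[of i] f[of j] ij by blast
      qed
    qed
    finally show ?thesis by (simp add: a_def)
  qed
  have symH: "symp ?H" by (intro sympI) (metis insert_commute)
  have "measure_pmf.prob (edge_law q) {b. \<not> good ?H s r b} \<le>
      4 ^ N * (1 - q) ^ ((m * k)\<^sup>2) + (real r)\<^sup>2 * (2 * exp (- L))"
  proof (rule prob_not_good_le[OF q m(1) rsN symH apos indH s(1)])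
    show "a \<le> N / 80" using ax Nx x(1) by linarith
    show "s \<le> N / 20" using s(2) Nx x(1) by (simp add: x_def)
    show "L \<le> s / 16" by (fact L)
    show "L \<le> (real s)\<^sup>2 / (64 * a)" using L(2) by (simp add: a_def)
  qed
  also have "4 ^ N * (1 - q) ^ ((m * k)\<^sup>2) \<le> exp (- (x / 10))"
  proof (rule four_power_times_le[OF q _ x(1) Nx])
    show "q * (real k)\<^sup>2 * x = 8" using n k by (auto simp: q_def x_def field_simps power2_eq_square)
    show "9 / 20 * real N \<le> real m" using m(2) by linarith
  qed
  finally have bad: "measure_pmf.prob (edge_law q) {b. \<not> good ?H s r b} \<le>
      exp (- (x / 10)) + (real r)\<^sup>2 * (2 * exp (- L))" by simp
  let ?T = "\<lambda>b. (V, {f \<in> [V]\<^bsup>2\<^esup>. b f})"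
  have "1 - measure_pmf.prob (edge_law q) {b. \<not> good ?H s r b} =
      measure_pmf.prob (edge_law q) {b. good ?H s r b}"
    using measure_pmf.prob_compl[of "{b. good ?H s r b}" "edge_law q"]
    by (simp add: Compl_eq[symmetric] Collect_neg_eq flip: Compl_eq_Diff_UNIV)
  also have "\<dots> \<le> measure_pmf.prob (edge_law q) (?T -` {R. r \<le> hadwiger_number (graph_union G R)})"
    by (intro measure_pmf.finite_measure_mono)
       (use good_imp_hadwiger[OF G _ linked s(1)] V_def in auto)
  also have "\<dots> = measure_pmf.prob (binomial_random_graph V q) {R. r \<le> hadwiger_number (graph_union G R)}"
    by (simp add: binomial_random_graph_def edge_law_def measure_map_pmf)
  finally show ?thesis using bad unfolding V_def q_def x_def by linarith
qed

lemma hadwiger_number_ge_1: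
  assumes K: "simple_graph K" and v: "v \<in> verts K"
  shows "1 \<le> hadwiger_number K"
proof -
  have "is_minor (complete_graph 1) K"
    by (rule is_minor_complete_graphI[OF K, where B = "\<lambda>_. {v}"])
       (use v in \<open>auto simp: disjoint_family_on_def\<close>)
  then show ?thesis
    unfolding hadwiger_number_def
    using hadwiger_set_finite_nonempty(1)[OF K] by (intro Max_ge) auto
qed

text \<open>Up to constants \<open>Z\<close> is the segment length and \<open>t\<close> the number
  of segments. Their product is \<open>n / (1000 * k)\<close>, a small share of all pieces. The
  union bound over segments is run with \<open>L = 4 * ln n\<close>.\<close>

lemma prob_hadwiger_bound:
  fixes G :: "'a graph" and k :: nat
  defines "n \<equiv> card (verts G)"
  defines "Q \<equiv> sqrt (ln (real n)) * max (sqrt (real (independence_number G))) (ln (real n)) * real k"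
  assumes G: "simple_graph G" and k: "k > 0" and n: "n \<ge> 8" "ln n \<ge> 16"
    and ind: "independence_number G \<le> n / (100 * real k)"
  shows "measure_pmf.prob (binomial_random_graph (verts G) (8 / (real n * real k)))
      {R. real (hadwiger_number (graph_union G R)) \<ge> 1 / 1000 * (real n / Q)} \<ge>
    1 - (exp (- (n / k / 10)) + 2 / (real n)\<^sup>2)"
proof -
  let ?M = "binomial_random_graph (verts G) (8 / (real n * real k))"
  define a where "a = real (independence_number G)"
  define l where "l = ln (real n)"
  define x where "x = real n / real k"
  define Z where "Z = sqrt l * max (sqrt a) l"
  define t where "t = 1 / 1000 * (real n / Q)"
  have l: "l \<ge> 16" using n(2) by (simp add: l_def)
  \<comment> \<open>Here \<open>ln n \<ge> 16\<close> enters: it yields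
    \<open>Z \<ge> 4 * l\<close>, and thus \<open>s / 16 \<ge> 4 * l\<close> later.\<close>
  have sl: "sqrt l \<ge> 4" using real_le_rsqrt[of 4 l] l by simp
  have Zl: "Z \<ge> 4 * l" unfolding Z_def using sl l by (intro mult_mono) auto
  have Z1: "Z \<ge> 1" using Zl l by linarith
  have Za: "Z\<^sup>2 \<ge> l * a"
  proof -
    have "sqrt l * sqrt a \<le> Z" unfolding Z_def using l by (intro mult_left_mono) auto
    then have "(sqrt l * sqrt a)\<^sup>2 \<le> Z\<^sup>2" using l by (intro power_mono) (auto simp: a_def)
    then show ?thesis using l by (simp add: power_mult_distrib a_def)
  qed
  have t: "t = x / (1000 * Z)" by (simp add: t_def Q_def x_def Z_def a_def l_def field_simps)
  show ?thesis
    \<comment> \<open>For \<open>t \<le> 1\<close> the bound is trivial, and otherwise \<open>s\<close> is small compared to \<open>n / k\<close>.\<close>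
  proof (cases "t \<le> 1")
    case True
    obtain v where v: "v \<in> verts G" using n(1) by (metis all_not_in_conv card.empty n_def not_numeral_le_zero)
    have "AE R in measure_pmf ?M. t \<le> real (hadwiger_number (graph_union G R))"
    proof (rule AE_pmfI)
      fix R assume "R \<in> set_pmf ?M"
      then obtain b where R: "R = (verts G, {e \<in> [verts G]\<^bsup>2\<^esup>. b e})"
        by (auto simp: binomial_random_graph_def)
      have "simple_graph (graph_union G R)"
        using G by (auto simp: simple_graph_def graph_union_def R)
      moreover have "v \<in> verts (graph_union G R)" using v by (simp add: graph_union_def)
      ultimately have "1 \<le> hadwiger_number (graph_union G R)" by (rule hadwiger_number_ge_1)
      then show "t \<le> real (hadwiger_number (graph_union G R))" using True by linarith
    qed
    then have "measure_pmf.prob ?M {R. t \<le> real (hadwiger_number (graph_union G R))} = 1"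
      by (intro measure_pmf.prob_eq_1[THEN iffD2]) auto
    moreover have "0 \<le> exp (- (n / k / 10)) + 2 / (real n)\<^sup>2" by (intro add_nonneg_nonneg) auto
    ultimately show ?thesis unfolding t_def by linarith
  next
    case False
    \<comment> \<open>The factor 16 makes the failure probability \<open>2 / n ^ 4\<close> per pair of segments.\<close>
    define s where "s = nat \<lceil>16 * Z\<rceil>"
    define r where "r = nat \<lceil>t\<rceil>"
    have s: "16 * Z \<le> s" "s \<le> 17 * Z" using Z1 unfolding s_def by linarith+
    \<comment> \<open>As \<open>t > 1\<close>, rounding up at most doubles it.\<close>
    have r: "t \<le> r" "r \<le> 2 * t" using False unfolding r_def by linarith+
    have tZ: "t * Z = x / 1000" using Z1 by (simp add: t)
    have Zx: "Z \<le> x / 1000" using False mult_right_mono[of 1 t Z] Z1 tZ by simp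
    have tx: "t \<le> x / 1000" using mult_left_mono[OF Z1, of t] False tZ by simp
    have "x \<le> n" using k mult_right_mono[of 1 "real k" "real n"] by (simp add: x_def field_simps)
    have apos: "a > 0"
    proof -
      obtain v where "v \<in> verts G" using n(1) by (metis all_not_in_conv card.empty n_def not_numeral_le_zero)
      then show ?thesis using card_le_independence_number[OF G, of "{v}"] by (simp add: a_def)
    qed
    have "1 - (exp (- (n / k / 10)) + (real r)\<^sup>2 * (2 * exp (- (4 * l)))) \<le>
      measure_pmf.prob ?M {R. r \<le> hadwiger_number (graph_union G R)}"
      unfolding n_def
    proof (rule prob_hadwiger_ge[OF G k _ _])
      show "8 \<le> card (verts G)" "real (independence_number G) \<le> card (verts G) / (100 * real k)"
        using n ind by (simp_all add: n_def)
      show "s > 0" using s(1) Z1 by linarith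
      show "s \<le> card (verts G) / (25 * real k)"
        using s(2) Zx Z1 by (simp add: x_def n_def)
      have "real r * real s \<le> (2 * t) * (17 * Z)" using r s False Z1 by (intro mult_mono) auto
      also have "\<dots> = 34 * (t * Z)" by simp
      also have "\<dots> \<le> 9 / 100 * x" unfolding tZ using Zx Z1 by linarith
      finally show "real (r * s) \<le> 9 / 100 * (card (verts G) / real k)"
        by (simp add: x_def n_def)
      show "4 * l \<le> s / 16" using s(1) Zl by linarith
      have "256 * (l * a) \<le> (16 * Z)\<^sup>2" using Za by (simp add: power_mult_distrib)
      also have "\<dots> \<le> (real s)\<^sup>2" using s(1) Z1 by (intro power_mono) auto
      finally show "4 * l \<le> (real s)\<^sup>2 / (64 * independence_number G)"
        using apos by (simp add: a_def field_simps)
    qed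
    moreover have "(real r)\<^sup>2 * (2 * exp (- (4 * l))) \<le> 2 / (real n)\<^sup>2"
    proof -
      have "exp l = n" using n(1) by (simp add: l_def)
      then have "exp (- (4 * l)) = 1 / (real n) ^ 4"
        by (simp add: exp_minus exp_of_nat_mult[of 4, simplified] divide_inverse)
      moreover have "real r \<le> n" using r(2) tx \<open>x \<le> n\<close> Zx Z1 by linarith
      then have "(real r)\<^sup>2 \<le> (real n)\<^sup>2" by (intro power_mono) auto
      ultimately have "(real r)\<^sup>2 * (2 * exp (- (4 * l))) \<le> (real n)\<^sup>2 * (2 * (1 / (real n) ^ 4))"
        by (simp add: divide_right_mono)
      also have "\<dots> = 2 / (real n)\<^sup>2"
        using n(1) by (simp add: field_simps flip: power_add)
      finally show ?thesis .
    qed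
    moreover have "measure_pmf.prob ?M {R. r \<le> hadwiger_number (graph_union G R)} \<le>
      measure_pmf.prob ?M {R. t \<le> real (hadwiger_number (graph_union G R))}"
    proof (intro measure_pmf.finite_measure_mono subsetI)
      fix R assume "R \<in> {R. r \<le> hadwiger_number (graph_union G R)}"
      then show "R \<in> {R. t \<le> real (hadwiger_number (graph_union G R))}"
        using r(1) by simp
    qed auto
    ultimately show ?thesis unfolding t_def by linarith
  qed
qed

section \<open>Convergence of the probability as \<open>n\<close> grows\<close>

theorem theorem1p2:
  shows "\<exists>c C :: real. c > 0 \<and> C > 0 \<and>
    (\<forall>(k :: nat \<Rightarrow> nat) (G :: nat \<Rightarrow> nat graph).
      (\<forall>n. k n > 0) \<longrightarrow>
      (\<lambda>n. real (k n)) \<in> o(\<lambda>n. real n) \<longrightarrow>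
      (\<forall>n. simple_graph (G n) \<and> card (verts (G n)) = n) \<longrightarrow>
      (\<forall>\<^sub>F n in sequentially. real (independence_number (G n)) \<le> c * real n / real (k n)) \<longrightarrow>
      (\<lambda>n. measure_pmf.prob (binomial_random_graph (verts (G n)) (8 / (real n * real (k n))))
             {R. real (hadwiger_number (graph_union (G n) R)) \<ge>
                 C * (real n / (sqrt (ln (real n)) *
                      max (sqrt (real (independence_number (G n)))) (ln (real n)) * real (k n)))})
        \<longlonglongrightarrow> 1)"
proof (rule exI[of _ "1 / 100"], rule exI[of _ "1 / 1000"], intro conjI allI impI)
  fix k :: "nat \<Rightarrow> nat" and G :: "nat \<Rightarrow> nat graph"
  assume k: "\<forall>n. k n > 0" and o: "(\<lambda>n. real (k n)) \<in> o(\<lambda>n. real n)"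
    and G: "\<forall>n. simple_graph (G n) \<and> card (verts (G n)) = n"
    and ind: "\<forall>\<^sub>F n in sequentially. real (independence_number (G n)) \<le> 1 / 100 * real n / real (k n)"
  let ?p = "\<lambda>n. measure_pmf.prob (binomial_random_graph (verts (G n)) (8 / (real n * real (k n))))
             {R. real (hadwiger_number (graph_union (G n) R)) \<ge>
                 1 / 1000 * (real n / (sqrt (ln (real n)) *
                      max (sqrt (real (independence_number (G n)))) (ln (real n)) * real (k n)))}"
  \<comment> \<open>\<open>k = o(n)\<close> means that \<open>n / k\<close> tends to infinity, which
    makes the failure term \<open>exp (- (n / k / 10))\<close> vanish.\<close>
  have "(\<lambda>n. real (k n) / real n) \<longlonglongrightarrow> 0" using o by (rule smalloD_tendsto)
  moreover have "\<forall>\<^sub>F n in sequentially. real (k n) / real n > 0"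
    using eventually_gt_at_top[of "0 :: nat"] by eventually_elim (use k in simp)
  ultimately have "filterlim (\<lambda>n. inverse (real (k n) / real n)) at_top sequentially"
    by (rule filterlim_inverse_at_top)
  then have lim: "filterlim (\<lambda>n. real n / real (k n)) at_top sequentially" by simp
  have "(\<lambda>n. 1 - (exp (- (real n / real (k n) / 10)) + 2 / (real n)\<^sup>2)) \<longlonglongrightarrow> 1 - (0 + 0)"
  proof (intro tendsto_intros)
    have "filterlim (\<lambda>n. 1 / 10 * (real n / real (k n))) at_top sequentially"
      using lim by (rule filterlim_tendsto_pos_mult_at_top[OF tendsto_const, rotated]) simp
    then have "filterlim (\<lambda>n. - (real n / real (k n) / 10)) at_bot sequentially"
      by (simp add: filterlim_uminus_at_bot mult.commute)
    then show "(\<lambda>n. exp (- (real n / real (k n) / 10))) \<longlonglongrightarrow> 0"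
      by (rule filterlim_compose[OF exp_at_bot])
    show "(\<lambda>n. 2 / (real n)\<^sup>2) \<longlonglongrightarrow> 0" by real_asymp
  qed
  then have lower: "(\<lambda>n. 1 - (exp (- (real n / real (k n) / 10)) + 2 / (real n)\<^sup>2)) \<longlonglongrightarrow> 1"
    by simp
  have "\<forall>\<^sub>F n in sequentially. 1 - (exp (- (real n / real (k n) / 10)) + 2 / (real n)\<^sup>2) \<le> ?p n"
  proof -
    have "\<forall>\<^sub>F n in sequentially. ln (real n) \<ge> 16" by real_asymp
    with ind eventually_ge_at_top[of "8 :: nat"] show ?thesis
    proof eventually_elim
      case (elim n)
      then show ?case
        using prob_hadwiger_bound[of "G n" "k n"] G k by simp
    qed
  qed
  moreover have "\<forall>\<^sub>F n in sequentially. ?p n \<le> 1"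
    by (intro always_eventually allI measure_pmf.prob_le_1)
  ultimately show "?p \<longlonglongrightarrow> 1"
    by (rule tendsto_sandwich[OF _ _ lower tendsto_const])
qed auto

end
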